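(* Let $\psi:[0,1]\to[0,\infty)$ be a non-negative, continuous function and let $\omega_1$ and $\omega_2$ be positive, continuous functions on $\mathbb{R}^+=[0,\infty)$. Assume that there exists a constant $C$ such that $$\int_0^1\omega_2(s/t)\,\frac{\psi(t)}{t}\,dt\le C\,\omega_1(s)\qquad\text{for every } s\in\mathbb{R}^+,$$ so that $U_\psi:L^1(\omega_1)\to L^1(\omega_2)$ is a bounded operator, and let $\overline{U}_\psi:M(\omega_1)\to M(\omega_2)$ be its extension. For $\mu\in M(\omega_1)$ and $x>0$ let $$(W_\psi\mu)(x)=\frac1x\int_{(0,x)}\psi(s/x)\,d\mu(s).$$ Then, for every $\mu\in M(\omega_1)$, $W_\psi\mu\in L^1(\omega_2)$ and $$\overline{U}_\psi\mu=W_\psi\mu+\int_0^1\frac{\psi(t)}{t}\,dt\cdot\mu(\{0\})\,\delta_0 .$$ In particular, $\operatorname{ran}\overline{U}_\psi\subseteq L^1(\omega_2)\oplus\mathbb{C}\delta_0$, and $\overline{U}_\psi$ maps $M((0,\infty),\omega_1)$ into $L^1(\omega_2)$.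
   Context: $\mathbb{R}^+=[0,\infty)$ with Lebesgue measure. For a positive, continuous function $\omega$ on $\mathbb{R}^+$: - $L^1(\omega)$ is the Banach space of (classes of) complex-valued measurable functions $f$ on $\mathbb{R}^+$ with $\|f\|_{L^1(\omega)}=\int_0^\infty|f(t)|\omega(t)\,dt<\infty$. - $L^\infty(1/\omega)$ is the space of (classes of) measurable functions $h$ on $\mathbb{R}^+$ with $\|h\|_{L^\infty(1/\omega)}=\operatorname{ess\,sup}_{t\in\mathbb{R}^+}|h(t)|/\omega(t)<\infty$; it is identified with the dual of $L^1(\omega)$ via $\langle f,h\rangle=\int_0^\infty f(t)h(t)\,dt$. - $C_0(1/\omega)$ is the closed subspace of $L^\infty(1/\omega)$ of continuous functions $g$ on $\mathbb{R}^+$ such that $g/\omega$ vanishes at infinity. - $M(\omega)$ is the space of locally finite complex Borel measures $\mu$ on $\mathbb{R}^+$ with $\|\mu\|_{M(\omega)}=\int_{\mathbb{R}^+}\omega(t)\,d|\mu|(t)<\infty$; it is identified with the dual of $C_0(1/\omega)$ via $\langle g,\mu\rangle=\int_{\mathbb{R}^+}g\,d\mu$. (Locally finite complex means complex-valued and countably additive on the Borel subsets of each compact subset of $\mathbb{R}^+$.) - $M((0,\infty),\omega)$ is the subspace of those $\mu\in M(\omega)$ with $\mu(\{0\})=0$. - $L^1(\omega)$ is regarded as a closed subspace of $M(\omega)$ by identifying $f$ with the measure $f(t)\,dt$. - $\delta_0$ is the unit point mass at $0$. The generalized Hardy-Cesàro operator is $(U_\psi f)(x)=\int_0^1 f(tx)\psi(t)\,dt=\frac1x\int_0^x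 f(s)\psi(s/x)\,ds$. Under the displayed integral condition it is a bounded operator from $L^1(\omega_1)$ to $L^1(\omega_2)$, and its adjoint $U_\psi^*:L^\infty(1/\omega_2)\to L^\infty(1/\omega_1)$, given by $(U_\psi^*h)(x)=\int_0^1h(x/t)\frac{\psi(t)}{t}\,dt$ for almost all $x$, maps $C_0(1/\omega_2)$ into $C_0(1/\omega_1)$. Let $V_\psi:C_0(1/\omega_2)\to C_0(1/\omega_1)$ be the restriction of $U_\psi^*$. Then $\overline{U}_\psi=V_\psi^*:M(\omega_1)\to M(\omega_2)$, which is a bounded extension of $U_\psi$. *)

theory Defs
  imports "HOL-Analysis.Analysis"
begin

text \<open>
  Functions on $[0,\infty)$ are functions on \<open>real\<close> of which only the values on \<open>{0..}\<close> matter.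
  Elements of $L^1(\omega)$ are represented by Borel functions; every class of Lebesgue measurable
  functions contains one.
\<close>

definition L1w :: "(real \<Rightarrow> real) \<Rightarrow> (real \<Rightarrow> complex) set" where
  "L1w \<omega> = {f. set_borel_measurable lborel {0..} f \<and>
     (\<integral>\<^sup>+t\<in>{0..}. ennreal (norm (f t) * \<omega> t) \<partial>lborel) < \<infinity>}"

text \<open>Setting \<open>g\<close> to 0 off \<open>{0..}\<close> makes equality in \<open>C0w\<close> equality of functions on $[0,\infty)$.\<close>

definition C0w :: "(real \<Rightarrow> real) \<Rightarrow> (real \<Rightarrow> complex) set" where
  "C0w \<omega> = {g. continuous_on {0..} g \<and> ((\<lambda>t. g t / complex_of_real (\<omega> t)) \<longlongrightarrow> 0) at_top \<and>
     (\<forall>t<0. g t = 0)}"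

definition cpt_borel :: "real set set" where
  "cpt_borel = {A \<in> sets borel. \<exists>K. compact K \<and> K \<subseteq> {0..} \<and> A \<subseteq> K}"

text \<open>
  A locally finite complex measure need not have values on unbounded sets; as a total set function
  it is extended by 0, so that equality and the vector space operations are those of functions.
\<close>

definition lf_complex_measure :: "(real set \<Rightarrow> complex) \<Rightarrow> bool" where
  "lf_complex_measure \<mu> \<longleftrightarrow>
     (\<forall>A. A \<notin> cpt_borel \<longrightarrow> \<mu> A = 0) \<and>
     (\<forall>E :: nat \<Rightarrow> real set. range E \<subseteq> cpt_borel \<longrightarrow> disjoint_family E \<longrightarrow> (\<Union>i. E i) \<in> cpt_borel \<longrightarrow>
        (\<lambda>i. \<mu> (E i)) sums \<mu> (\<Union>i. E i))"

definition total_variation :: "(real set \<Rightarrow> complex) \<Rightarrow> real measure" where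
  "total_variation \<mu> = measure_of {0..} (sets (restrict_space borel {0..}))
     (\<lambda>A. SUP P\<in>{P. finite P \<and> disjoint P \<and> P \<subseteq> cpt_borel \<and> \<Union>P \<subseteq> A}. \<Sum>E\<in>P. ennreal (norm (\<mu> E)))"

text \<open>
  The positive part in the Jordan decomposition of a real set function \<open>\<nu>\<close>; the negative part is
  that of \<open>-\<nu>\<close>. Negative values of \<open>\<nu>\<close> are truncated to 0 by \<open>ennreal\<close>, which does not change the
  supremum because \<open>\<nu> {} = 0\<close>.
\<close>

definition pos_variation :: "(real set \<Rightarrow> real) \<Rightarrow> real measure" where
  "pos_variation \<nu> = measure_of {0..} (sets (restrict_space borel {0..}))
     (\<lambda>A. SUP B\<in>{B \<in> cpt_borel. B \<subseteq> A}. ennreal (\<nu> B))"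

definition cm_integral :: "(real set \<Rightarrow> complex) \<Rightarrow> (real \<Rightarrow> complex) \<Rightarrow> complex" where
  "cm_integral \<mu> g =
     (integral\<^sup>L (pos_variation (\<lambda>A. Re (\<mu> A))) g - integral\<^sup>L (pos_variation (\<lambda>A. - Re (\<mu> A))) g)
     + \<i> * (integral\<^sup>L (pos_variation (\<lambda>A. Im (\<mu> A))) g - integral\<^sup>L (pos_variation (\<lambda>A. - Im (\<mu> A))) g)"

definition Mw :: "(real \<Rightarrow> real) \<Rightarrow> (real set \<Rightarrow> complex) set" where
  "Mw \<omega> = {\<mu>. lf_complex_measure \<mu> \<and> (\<integral>\<^sup>+t. ennreal (\<omega> t) \<partial>total_variation \<mu>) < \<infinity>}"

definition Mw_pos :: "(real \<Rightarrow> real) \<Rightarrow> (real set \<Rightarrow> complex) set" where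
  "Mw_pos \<omega> = {\<mu> \<in> Mw \<omega>. \<mu> {0} = 0}"

definition ac_measure :: "(real \<Rightarrow> complex) \<Rightarrow> real set \<Rightarrow> complex" where
  "ac_measure f A = (if A \<in> cpt_borel then (LINT t:A|lborel. f t) else 0)"

definition delta0 :: "real set \<Rightarrow> complex" where
  "delta0 A = (if A \<in> cpt_borel \<and> 0 \<in> A then 1 else 0)"

text \<open>Internal direct sum: the decomposition is required to be unique.\<close>

definition direct_sum ::
    "(real set \<Rightarrow> complex) set \<Rightarrow> (real set \<Rightarrow> complex) set \<Rightarrow> (real set \<Rightarrow> complex) set" where
  "direct_sum X Y = {\<nu>. \<exists>!p. fst p \<in> X \<and> snd p \<in> Y \<and> \<nu> = (\<lambda>A. fst p A + snd p A)}"

definition pairing :: "(real \<Rightarrow> complex) \<Rightarrow> (real \<Rightarrow> complex) \<Rightarrow> complex" where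
  "pairing f h = (LINT t:{0..}|lborel. f t * h t)"

definition U_op :: "(real \<Rightarrow> real) \<Rightarrow> (real \<Rightarrow> complex) \<Rightarrow> real \<Rightarrow> complex" where
  "U_op \<psi> f x = (LINT t:{0..1}|lborel. f (t * x) * complex_of_real (\<psi> t))"

text \<open>
  \<open>V_op\<close> is the adjoint of \<open>U_op \<psi>\<close> from $L^1(\omega_1)$ to $L^1(\omega_2)$, restricted to
  $C_0(1/\omega_2)$: it picks the continuous representative of the class in $L^\infty(1/\omega_1)$,
  which is $x \mapsto \int_0^1 g(x/t)\,\psi(t)/t\,dt$. \<open>Ubar\<close> is the adjoint of \<open>V_op\<close>, with
  $M(\omega_i)$ as the dual of $C_0(1/\omega_i)$.
\<close>

definition V_op ::
    "(real \<Rightarrow> real) \<Rightarrow> (real \<Rightarrow> real) \<Rightarrow> (real \<Rightarrow> real) \<Rightarrow> (real \<Rightarrow> complex) \<Rightarrow> real \<Rightarrow> complex" where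
  "V_op \<psi> \<omega>1 \<omega>2 g =
     (THE k. k \<in> C0w \<omega>1 \<and> (\<forall>f\<in>L1w \<omega>1. pairing f k = pairing (U_op \<psi> f) g))"

definition Ubar ::
    "(real \<Rightarrow> real) \<Rightarrow> (real \<Rightarrow> real) \<Rightarrow> (real \<Rightarrow> real) \<Rightarrow> (real set \<Rightarrow> complex) \<Rightarrow> real set \<Rightarrow> complex" where
  "Ubar \<psi> \<omega>1 \<omega>2 \<mu> =
     (THE \<nu>. \<nu> \<in> Mw \<omega>2 \<and> (\<forall>g\<in>C0w \<omega>2. cm_integral \<nu> g = cm_integral \<mu> (V_op \<psi> \<omega>1 \<omega>2 g)))"

definition W_op :: "(real \<Rightarrow> real) \<Rightarrow> (real set \<Rightarrow> complex) \<Rightarrow> real \<Rightarrow> complex" where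
  "W_op \<psi> \<mu> x = complex_of_real (1 / x) *
     cm_integral \<mu> (\<lambda>s. indicator {0<..<x} s * complex_of_real (\<psi> (s / x)))"

end

theory Submission
  imports Defs
begin

text \<open>
  The formula is Fubini's theorem. Put \<open>K s x = \<psi> (s / x) / x\<close> for \<open>0 < s < x\<close> and \<open>K s x = 0\<close>
  otherwise. For \<open>s > 0\<close> the substitution \<open>t = s / x\<close> turns
  $\int_0^1 g(s/t)\,\psi(t)/t\,dt$, the value at \<open>s\<close> of the adjoint operator on \<open>g\<close>, into
  $\int g(x)\,K(s,x)\,dx$. Integrating against \<open>\<mu>\<close> over $(0,\infty)$ and exchanging the order of
  integration gives $\int g(x)\,(W_\psi\mu)(x)\,dx$. With \<open>\<omega>2\<close> in place of \<open>g\<close> and \<open>\<bar>\<mu>\<bar>\<close> in place of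
  \<open>\<mu>\<close>, the hypothesis bounds the double integral by $C\int\omega_1\,d|\mu|$; this one estimate
  justifies the exchange and shows that $W_\psi\mu$ lies in $L^1(\omega_2)$. The substitution fails
  at \<open>s = 0\<close> only, where the adjoint takes the value $g(0)\int_0^1\psi(t)/t\,dt$: a mass of \<open>\<mu>\<close> at
  the origin is not spread out, and contributes the multiple of $\delta_0$.

  The exchange is \<open>integral_V\<close>, for a positive measure \<open>p\<close> and a complex density \<open>h\<close>. It is used
  twice. With \<open>p\<close> Lebesgue measure and \<open>h \<in> L1w \<omega>1\<close> it is the adjoint identity, so that \<open>V_op\<close> is
  the explicit integral operator \<open>V\<close> (\<open>V_op_eq\<close>); that \<open>V\<close> maps into $C_0(1/\omega_1)$ follows by
  approximating \<open>g\<close> by functions of compact support (\<open>V_C0w\<close>). With \<open>h = 1\<close> and \<open>p\<close> one of the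
  four positive measures of which \<open>\<mu>\<close> is a linear combination with coefficients $\pm 1$, $\pm i$,
  it is the formula itself.

  Three facts on complex measures connect these integrals with the definitions. The total
  variation and the four positive parts are countably additive, and they are finite on compact sets
  because $\int\omega_1\,d|\mu|$ is finite and \<open>\<omega>1\<close> is bounded below there (\<open>jordan_decomposition\<close>).
  An element of $M(\omega)$ is determined by its integrals against $C_0(1/\omega)$ (\<open>Mw_eqI\<close>),
  which makes the measure representing the adjoint unique. Finally, if a complex measure is given by
  a density with respect to a positive measure, then its positive parts are given by the positive
  parts of the density (\<open>jordan_part_density\<close>), so that integrals against it can be computed
  (\<open>cm_integral_density\<close>).
\<close>

section \<open>Bounded Borel subsets of the half-line\<close>


abbreviation half_line :: "real measure" where
  "half_line \<equiv> restrict_space borel {0..}"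

lemma sets_half_line: "A \<in> sets half_line \<longleftrightarrow> A \<in> sets borel \<and> A \<subseteq> {0..}"
  by (subst sets_restrict_space_iff) auto

lemma cpt_borel_iff: "A \<in> cpt_borel \<longleftrightarrow> A \<in> sets half_line \<and> bounded A"
proof
  assume "A \<in> cpt_borel"
  then show "A \<in> sets half_line \<and> bounded A"
    by (auto simp: cpt_borel_def sets_half_line intro: bounded_subset compact_imp_bounded)
next
  assume A: "A \<in> sets half_line \<and> bounded A"
  then obtain b where b: "\<And>x. x \<in> A \<Longrightarrow> \<bar>x\<bar> \<le> b"
    by (auto simp: bounded_iff)
  have "compact {0..b}" "{0..b} \<subseteq> {0..}" "A \<subseteq> {0..b}"
    using b A by (fastforce simp: sets_half_line)+
  then show "A \<in> cpt_borel"
    using A unfolding cpt_borel_def sets_half_line by blast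
qed

lemma cpt_borelD: "A \<in> cpt_borel \<Longrightarrow> A \<in> sets half_line" "A \<in> cpt_borel \<Longrightarrow> bounded A"
  by (simp_all add: cpt_borel_iff)

lemma cpt_borel_simps [simp]:
  "{} \<in> cpt_borel" "a \<ge> 0 \<Longrightarrow> {a..b} \<in> cpt_borel" "{0} \<in> cpt_borel"
  by (auto simp: cpt_borel_iff sets_half_line)

lemma cpt_borel_Int: "A \<in> cpt_borel \<Longrightarrow> B \<in> sets half_line \<Longrightarrow> A \<inter> B \<in> cpt_borel"
  by (auto simp: cpt_borel_iff intro: bounded_subset)

lemma cpt_borel_Diff: "A \<in> cpt_borel \<Longrightarrow> B \<in> cpt_borel \<Longrightarrow> A - B \<in> cpt_borel"
  by (auto simp: cpt_borel_iff intro: bounded_subset)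

lemma cpt_borel_Un: "A \<in> cpt_borel \<Longrightarrow> B \<in> cpt_borel \<Longrightarrow> A \<union> B \<in> cpt_borel"
  by (auto simp: cpt_borel_iff)

lemma cpt_borel_Union: "finite P \<Longrightarrow> P \<subseteq> cpt_borel \<Longrightarrow> \<Union>P \<in> cpt_borel"
  by (induction P rule: finite_induct) (auto intro: cpt_borel_Un)

lemma cpt_borel_obtain:
  assumes "A \<in> cpt_borel"
  obtains b where "b \<ge> 0" "A \<subseteq> {0..b}"
proof -
  obtain b where b: "\<And>x. x \<in> A \<Longrightarrow> \<bar>x\<bar> \<le> b"
    using assms by (auto simp: cpt_borel_iff bounded_iff)
  have "A \<subseteq> {0..max 0 b}" using b assms by (fastforce simp: cpt_borel_iff sets_half_line)
  then show thesis by (rule that[rotated]) simp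
qed

section \<open>Locally finite complex measures\<close>

lemma lf_complex_measureD:
  assumes "lf_complex_measure \<mu>"
  shows "A \<notin> cpt_borel \<Longrightarrow> \<mu> A = 0"
    and "range E \<subseteq> cpt_borel \<Longrightarrow> disjoint_family E \<Longrightarrow> (\<Union>i::nat. E i) \<in> cpt_borel \<Longrightarrow>
        (\<lambda>i. \<mu> (E i)) sums \<mu> (\<Union>i. E i)"
  using assms unfolding lf_complex_measure_def by blast+

lemma lf_complex_measure_empty:
  assumes "lf_complex_measure \<mu>" shows "\<mu> {} = 0"
proof -
  have "(\<lambda>i::nat. \<mu> {}) sums \<mu> {}"
    using lf_complex_measureD(2)[OF assms, of "\<lambda>_. {}"] by (auto simp: disjoint_family_on_def)
  then have "(\<lambda>i::nat. \<mu> {}) \<longlonglongrightarrow> 0"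
    using summable_LIMSEQ_zero sums_summable by blast
  then show ?thesis by (simp add: LIMSEQ_const_iff)
qed

lemma lf_complex_measure_Un:
  assumes mu: "lf_complex_measure \<mu>" and AB: "A \<in> cpt_borel" "B \<in> cpt_borel" "A \<inter> B = {}"
  shows "\<mu> (A \<union> B) = \<mu> A + \<mu> B"
proof -
  define E where "E = (\<lambda>i::nat. if i = 0 then A else if i = 1 then B else {})"
  have U: "(\<Union>i. E i) = A \<union> B"
    unfolding E_def by (auto split: if_splits)
  have "range E \<subseteq> cpt_borel" "disjoint_family E" "(\<Union>i. E i) \<in> cpt_borel"
    using AB cpt_borel_Un[of A B] unfolding U by (auto simp: E_def disjoint_family_on_def)
  from lf_complex_measureD(2)[OF mu this] have "(\<lambda>i. \<mu> (E i)) sums \<mu> (A \<union> B)"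
    by (simp only: U)
  moreover have "(\<lambda>i. \<mu> (E i)) sums (\<Sum>i\<in>{0,1}. \<mu> (E i))"
    by (rule sums_finite) (auto simp: E_def lf_complex_measure_empty[OF mu])
  ultimately have "\<mu> (A \<union> B) = (\<Sum>i\<in>{0,1}. \<mu> (E i))"
    by (rule sums_unique2)
  then show ?thesis by (simp add: E_def)
qed

lemma lf_complex_measure_Union:
  assumes mu: "lf_complex_measure \<mu>" and "finite P" "disjoint P" "P \<subseteq> cpt_borel"
  shows "\<mu> (\<Union>P) = (\<Sum>E\<in>P. \<mu> E)"
  using assms(2-)
proof (induction P rule: finite_induct)
  case (insert E P)
  have "E \<inter> \<Union>P = {}"
    using insert.hyps insert.prems(1) by (auto simp: disjoint_def)
  then have "\<mu> (E \<union> \<Union>P) = \<mu> E + \<mu> (\<Union>P)"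
    using insert.prems insert.hyps by (intro lf_complex_measure_Un[OF mu] cpt_borel_Union) auto
  moreover have "\<mu> (\<Union>P) = (\<Sum>E\<in>P. \<mu> E)"
    using insert.prems by (intro insert.IH) (auto simp: disjoint_def)
  ultimately show ?case using insert.hyps by simp
qed (simp add: lf_complex_measure_empty[OF mu])

section \<open>Variations of a complex measure\<close>

definition cpt_families :: "real set \<Rightarrow> real set set set" where
  "cpt_families A = {P. finite P \<and> disjoint P \<and> P \<subseteq> cpt_borel \<and> \<Union>P \<subseteq> A}"

text \<open>
  With \<open>f = norm\<close> this is the total variation. With \<open>f\<close> the real part of a multiple it is
  a Jordan part: a finite disjoint family can then be replaced by the union of its members of positive
  value (\<open>variation_Re_along\<close>). Both are measures for the same reason, namely that \<open>f\<close> is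
  continuous and subadditive.
\<close>

definition variation :: "(complex \<Rightarrow> real) \<Rightarrow> (real set \<Rightarrow> complex) \<Rightarrow> real set \<Rightarrow> ennreal" where
  "variation f \<mu> A = (SUP P\<in>cpt_families A. \<Sum>E\<in>P. ennreal (f (\<mu> E)))"

definition variation_measure :: "(complex \<Rightarrow> real) \<Rightarrow> (real set \<Rightarrow> complex) \<Rightarrow> real measure" where
  "variation_measure f \<mu> = measure_of {0..} (sets half_line) (variation f \<mu>)"

lemma space_sets_variation_measure [simp]:
  "space (variation_measure f \<mu>) = {0..}" "sets (variation_measure f \<mu>) = sets half_line"
proof -
  have *: "sets half_line \<subseteq> Pow {0..}" by (auto simp: sets_half_line)
  show "space (variation_measure f \<mu>) = {0..}"
    unfolding variation_measure_def using * by (rule space_measure_of)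
  have "sets (variation_measure f \<mu>) = sigma_sets {0..} (sets half_line)"
    unfolding variation_measure_def using * by (rule sets_measure_of)
  also have "\<dots> = sets half_line"
    using sets.sigma_sets_eq[of half_line] by (simp add: space_restrict_space)
  finally show "sets (variation_measure f \<mu>) = sets half_line" .
qed

lemma variation_mono: "A \<subseteq> B \<Longrightarrow> variation f \<mu> A \<le> variation f \<mu> B"
  unfolding variation_def by (intro SUP_subset_mono) (auto simp: cpt_families_def)

lemma variation_upper: "P \<in> cpt_families A \<Longrightarrow> (\<Sum>E\<in>P. ennreal (f (\<mu> E))) \<le> variation f \<mu> A"
  unfolding variation_def by (rule SUP_upper)

lemma variation_upper1:
  assumes "A \<in> cpt_borel" "A \<subseteq> B" shows "ennreal (f (\<mu> A)) \<le> variation f \<mu> B"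
  using variation_upper[of "{A}" B f \<mu>] assms by (simp add: cpt_families_def)

lemma ennreal_add_le: "ennreal (a + b) \<le> ennreal a + ennreal b"
proof -
  have "ennreal (a + b) \<le> ennreal (max 0 a + max 0 b)"
    by (intro ennreal_leI add_mono) auto
  also have "\<dots> = ennreal (max 0 a) + ennreal (max 0 b)"
    by (rule ennreal_plus) auto
  finally show ?thesis by (simp add: ennreal_max_0)
qed

locale subadditive_gauge =
  fixes f :: "complex \<Rightarrow> real"
  assumes zero: "f 0 = 0"
    and cont: "continuous_on UNIV f"
    and subadd: "f (a + b) \<le> f a + f b"
begin

lemma countably_subadditive:
  assumes mu: "lf_complex_measure \<mu>"
    and E: "range E \<subseteq> cpt_borel" "disjoint_family E" "(\<Union>i::nat. E i) \<in> cpt_borel"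
  shows "ennreal (f (\<mu> (\<Union>i. E i))) \<le> (\<Sum>i. ennreal (f (\<mu> (E i))))"
proof -
  have part: "ennreal (f (\<Sum>i<n. \<mu> (E i))) \<le> (\<Sum>i<n. ennreal (f (\<mu> (E i))))" for n
  proof (induction n)
    case (Suc n)
    have "ennreal (f (\<Sum>i<Suc n. \<mu> (E i))) \<le> ennreal (f (\<Sum>i<n. \<mu> (E i)) + f (\<mu> (E n)))"
      by (simp add: ennreal_leI subadd)
    also have "\<dots> \<le> ennreal (f (\<Sum>i<n. \<mu> (E i))) + ennreal (f (\<mu> (E n)))"
      by (rule ennreal_add_le)
    also have "\<dots> \<le> (\<Sum>i<Suc n. ennreal (f (\<mu> (E i))))"
      using Suc by (simp add: add_right_mono)
    finally show ?case .
  qed (simp add: zero)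
  have "(\<lambda>n. \<Sum>i<n. \<mu> (E i)) \<longlonglongrightarrow> \<mu> (\<Union>i. E i)"
    using lf_complex_measureD(2)[OF mu E] by (simp add: sums_def)
  then have "(\<lambda>n. f (\<Sum>i<n. \<mu> (E i))) \<longlonglongrightarrow> f (\<mu> (\<Union>i. E i))"
    using cont by (auto intro: continuous_on_tendsto_compose)
  then have "(\<lambda>n. ennreal (f (\<Sum>i<n. \<mu> (E i)))) \<longlonglongrightarrow> ennreal (f (\<mu> (\<Union>i. E i)))"
    by (rule tendsto_ennrealI)
  then show ?thesis
    by (rule LIMSEQ_le_const2)
      (auto intro!: order_trans[OF part] sum_le_suminf)
qed

text \<open>
  Families in two disjoint sets combine to one in the union. They can share the empty set,
  which contributes nothing.
\<close>

lemma variation_superadditive: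
  assumes mu: "lf_complex_measure \<mu>" and AB: "A \<inter> B = {}"
  shows "variation f \<mu> A + variation f \<mu> B \<le> variation f \<mu> (A \<union> B)"
proof -
  have PQ: "(\<Sum>E\<in>P. ennreal (f (\<mu> E))) + (\<Sum>E\<in>Q. ennreal (f (\<mu> E))) \<le> variation f \<mu> (A \<union> B)"
    if P: "P \<in> cpt_families A" and Q: "Q \<in> cpt_families B" for P Q
  proof -
    have "E = {}" if "E \<in> P" "E \<in> Q" for E
    proof -
      have "E \<subseteq> A" "E \<subseteq> B" using that P Q by (auto simp: cpt_families_def)
      then show ?thesis using AB by auto
    qed
    then have "ennreal (f (\<mu> E)) = 0" if "E \<in> P \<inter> Q" for E
      using that lf_complex_measure_empty[OF mu] zero by force
    then have "(\<Sum>E\<in>P\<inter>Q. ennreal (f (\<mu> E))) = 0"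
      by (intro sum.neutral) blast
    then have "(\<Sum>E\<in>P. ennreal (f (\<mu> E))) + (\<Sum>E\<in>Q. ennreal (f (\<mu> E))) = (\<Sum>E\<in>P\<union>Q. ennreal (f (\<mu> E)))"
      using sum.union_inter[of P Q "\<lambda>E. ennreal (f (\<mu> E))"] P Q by (simp add: cpt_families_def)
    moreover have "P \<union> Q \<in> cpt_families (A \<union> B)"
    proof -
      have "\<Union>P \<subseteq> A" "\<Union>Q \<subseteq> B" using P Q by (simp_all add: cpt_families_def)
      then have "\<Union>P \<inter> \<Union>Q = {}" "\<Union>(P \<union> Q) \<subseteq> A \<union> B" using AB by auto
      then show ?thesis using P Q by (simp add: cpt_families_def disjoint_union)
    qed
    ultimately show ?thesis using variation_upper by metis
  qed
  have ne: "cpt_families X \<noteq> {}" for X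
  proof -
    have "{} \<in> cpt_families X" by (simp add: cpt_families_def)
    then show ?thesis by blast
  qed
  let ?s = "\<lambda>P. \<Sum>E\<in>P. ennreal (f (\<mu> E))"
  have "?s P + variation f \<mu> B \<le> variation f \<mu> (A \<union> B)" if "P \<in> cpt_families A" for P
  proof -
    have "?s P + variation f \<mu> B = (SUP Q\<in>cpt_families B. ?s P + ?s Q)"
      unfolding variation_def[of f \<mu> B] by (simp add: ennreal_SUP_add_right[OF ne])
    also have "\<dots> \<le> variation f \<mu> (A \<union> B)" by (intro SUP_least PQ that)
    finally show ?thesis .
  qed
  then have "(SUP P\<in>cpt_families A. ?s P + variation f \<mu> B) \<le> variation f \<mu> (A \<union> B)"
    by (intro SUP_least)
  then show ?thesis
    unfolding variation_def[of f \<mu> A] by (simp only: ennreal_SUP_add_left[OF ne])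
qed

text \<open>
  Cut every member of a family along the sets \<open>A i\<close>. Different members may have the same
  trace on \<open>A i\<close>, but only if that trace is empty.
\<close>

lemma variation_countably_subadditive:
  assumes mu: "lf_complex_measure \<mu>"
    and A: "range A \<subseteq> sets half_line" "disjoint_family A"
  shows "variation f \<mu> (\<Union>i::nat. A i) \<le> (\<Sum>i. variation f \<mu> (A i))"
  unfolding variation_def[of f \<mu> "\<Union>i. A i"]
proof (rule SUP_least)
  fix P assume P: "P \<in> cpt_families (\<Union>i. A i)"
  let ?g = "\<lambda>E. ennreal (f (\<mu> E))"
  have "(\<Sum>E\<in>P. ?g E) \<le> (\<Sum>E\<in>P. \<Sum>i. ?g (E \<inter> A i))"
  proof (rule sum_mono)
    fix E assume E: "E \<in> P"
    then have UE: "(\<Union>i. E \<inter> A i) = E" and "E \<in> cpt_borel"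
      using P by (auto simp: cpt_families_def)
    have "?g (\<Union>i. E \<inter> A i) \<le> (\<Sum>i. ?g (E \<inter> A i))"
    proof (rule countably_subadditive[OF mu])
      show "range (\<lambda>i. E \<inter> A i) \<subseteq> cpt_borel"
        using A(1) \<open>E \<in> cpt_borel\<close> by (auto intro!: cpt_borel_Int)
      show "disjoint_family (\<lambda>i. E \<inter> A i)"
        using A(2) unfolding disjoint_family_on_def by blast
    qed (unfold UE, fact)
    then show "?g E \<le> (\<Sum>i. ?g (E \<inter> A i))" by (simp only: UE)
  qed
  also have "\<dots> = (\<Sum>i. \<Sum>E\<in>P. ?g (E \<inter> A i))"
    by (subst suminf_sum) auto
  also have "\<dots> \<le> (\<Sum>i. variation f \<mu> (A i))"
  proof (rule suminf_le)
    fix i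
    have "(\<Sum>E\<in>P. ?g (E \<inter> A i)) = (\<Sum>F\<in>(\<lambda>E. E \<inter> A i) ` P. ?g F)"
    proof (rule sum.reindex_nontrivial[symmetric, unfolded o_def])
      fix E F assume "E \<in> P" "F \<in> P" "E \<noteq> F" "E \<inter> A i = F \<inter> A i"
      then have "E \<inter> A i = {}"
        using P by (auto simp: cpt_families_def disjoint_def)
      then show "?g (E \<inter> A i) = 0" by (simp add: lf_complex_measure_empty[OF mu] zero)
    qed (use P in \<open>simp add: cpt_families_def\<close>)
    also have "(\<lambda>E. E \<inter> A i) ` P \<in> cpt_families (A i)"
      using P A(1) unfolding cpt_families_def disjoint_def
      by (auto intro!: cpt_borel_Int)
    then have "(\<Sum>F\<in>(\<lambda>E. E \<inter> A i) ` P. ?g F) \<le> variation f \<mu> (A i)"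
      by (rule variation_upper)
    finally show "(\<Sum>E\<in>P. ?g (E \<inter> A i)) \<le> variation f \<mu> (A i)" .
  qed auto
  finally show "(\<Sum>E\<in>P. ?g E) \<le> (\<Sum>i. variation f \<mu> (A i))" .
qed

lemma variation_empty:
  assumes "lf_complex_measure \<mu>" shows "variation f \<mu> {} = 0"
proof -
  have "(\<Sum>E\<in>P. ennreal (f (\<mu> E))) = 0" if "P \<in> cpt_families {}" for P
    using that by (intro sum.neutral) (auto simp: cpt_families_def lf_complex_measure_empty[OF assms] zero)
  then have "variation f \<mu> {} \<le> 0" unfolding variation_def by (intro SUP_least) simp
  then show ?thesis by simp
qed

lemma emeasure_variation_measure:
  assumes mu: "lf_complex_measure \<mu>" and A: "A \<in> sets half_line"
  shows "emeasure (variation_measure f \<mu>) A = variation f \<mu> A"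
proof (rule emeasure_measure_of[OF variation_measure_def])
  let ?S = "sets (variation_measure f \<mu>)"
  show "positive ?S (variation f \<mu>)"
    using variation_empty[OF mu] by (simp add: positive_def)
  show "countably_additive ?S (variation f \<mu>)"
  proof (rule countably_additiveI, rule antisym)
    fix A :: "nat \<Rightarrow> real set"
    assume A: "range A \<subseteq> ?S" "disjoint_family A"
    show "variation f \<mu> (\<Union>i. A i) \<le> (\<Sum>i. variation f \<mu> (A i))"
      using variation_countably_subadditive[OF mu] A by simp
    have "(\<Sum>i<n. variation f \<mu> (A i)) \<le> variation f \<mu> (\<Union>i<n. A i)" for n
    proof (induction n)
      case (Suc n)
      have "(\<Union>i<n. A i) \<inter> A n = {}"
        using A(2) by (simp add: disjoint_family_on_def UN_extend_simps Int_commute)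
      then have "variation f \<mu> (\<Union>i<n. A i) + variation f \<mu> (A n) \<le> variation f \<mu> ((\<Union>i<n. A i) \<union> A n)"
        by (rule variation_superadditive[OF mu])
      moreover have "(\<Union>i<n. A i) \<union> A n = (\<Union>i<Suc n. A i)"
        by (auto simp: less_Suc_eq)
      ultimately show ?case
        using Suc by (simp add: order_trans[OF add_right_mono])
    qed simp
    also have "variation f \<mu> (\<Union>i<n. A i) \<le> variation f \<mu> (\<Union>i. A i)" for n
      by (intro variation_mono) auto
    finally show "(\<Sum>i. variation f \<mu> (A i)) \<le> variation f \<mu> (\<Union>i. A i)"
      by (intro suminf_le_const summableI)
  qed
qed (use A in \<open>auto simp: sets_half_line\<close>)

end

lemma total_variation_eq: "total_variation \<mu> = variation_measure norm \<mu>"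
  unfolding total_variation_def variation_measure_def variation_def cpt_families_def ..

interpretation norm_gauge: subadditive_gauge norm
  by standard (auto intro: continuous_intros norm_triangle_ineq)

text \<open>
  For \<open>c\<close> equal to \<open>1\<close>, \<open>-1\<close>, \<open>\<i>\<close>, \<open>-\<i>\<close> this is \<open>Re z\<close>, \<open>- Re z\<close>, \<open>Im z\<close>, \<open>- Im z\<close>. Thus the four
  measures in \<open>cm_integral\<close> become instances of one definition, and \<open>c\<close> is also the coefficient with
  which each of them enters.
\<close>

definition Re_along :: "complex \<Rightarrow> complex \<Rightarrow> real" where
  "Re_along c z = Re (cnj c * z)"

interpretation Re_gauge: subadditive_gauge "Re_along c" for c
  by standard (auto simp: Re_along_def distrib_left intro!: continuous_intros)

lemma bounded_linear_Re_along: "bounded_linear (Re_along c)"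
  unfolding Re_along_def using bounded_linear_compose[OF bounded_linear_Re bounded_linear_mult_right] .

definition jordan_part :: "complex \<Rightarrow> (real set \<Rightarrow> complex) \<Rightarrow> real measure" where
  "jordan_part c \<mu> = pos_variation (\<lambda>A. Re_along c (\<mu> A))"

definition units4 :: "complex set" where "units4 = {1, -1, \<i>, -\<i>}"

lemma sum_units4: "(\<Sum>c\<in>units4. F c) = F 1 + F (-1) + F \<i> + F (-\<i>)" for F :: "complex \<Rightarrow> 'b::comm_monoid_add"
  unfolding units4_def by (simp add: complex_eq_iff add.assoc)

lemma norm_units4: "c \<in> units4 \<Longrightarrow> norm c = 1"
  by (auto simp: units4_def)

lemma cm_integral_eq:
  "cm_integral \<mu> g = (\<Sum>c\<in>units4. c * integral\<^sup>L (jordan_part c \<mu>) g)"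
  unfolding cm_integral_def jordan_part_def sum_units4 Re_along_def by (simp add: algebra_simps)

lemma variation_Re_along:
  assumes mu: "lf_complex_measure \<mu>"
  shows "variation (Re_along c) \<mu> A = (SUP B\<in>{B \<in> cpt_borel. B \<subseteq> A}. ennreal (Re_along c (\<mu> B)))"
proof (rule antisym)
  let ?\<nu> = "\<lambda>A. Re_along c (\<mu> A)"
  show "(SUP B\<in>{B \<in> cpt_borel. B \<subseteq> A}. ennreal (?\<nu> B)) \<le> variation (Re_along c) \<mu> A"
    by (rule SUP_least) (auto intro: variation_upper1)
  show "variation (Re_along c) \<mu> A \<le> (SUP B\<in>{B \<in> cpt_borel. B \<subseteq> A}. ennreal (?\<nu> B))"
    unfolding variation_def
  proof (rule SUP_least)
    fix P assume P: "P \<in> cpt_families A"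
    define Q where "Q = {E \<in> P. 0 \<le> ?\<nu> E}"
    have Q: "finite Q" "disjoint Q" "Q \<subseteq> cpt_borel" "\<Union>Q \<subseteq> A"
      using P by (auto simp: Q_def cpt_families_def disjoint_def)
    have "(\<Sum>E\<in>P. ennreal (?\<nu> E)) = (\<Sum>E\<in>Q. ennreal (?\<nu> E))"
      using P by (intro sum.mono_neutral_right) (auto simp: Q_def cpt_families_def ennreal_eq_0_iff)
    also have "\<dots> = ennreal (\<Sum>E\<in>Q. ?\<nu> E)"
      by (rule sum_ennreal) (auto simp: Q_def)
    also have "(\<Sum>E\<in>Q. ?\<nu> E) = ?\<nu> (\<Union>Q)"
      unfolding lf_complex_measure_Union[OF mu Q(1-3)] Re_along_def
      by (metis Re_sum sum_distrib_left)
    finally show "(\<Sum>E\<in>P. ennreal (?\<nu> E)) \<le> (SUP B\<in>{B \<in> cpt_borel. B \<subseteq> A}. ennreal (?\<nu> B))"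
      using Q cpt_borel_Union[of Q] by (auto intro: SUP_upper)
  qed
qed

lemma jordan_part_eq:
  assumes mu: "lf_complex_measure \<mu>"
  shows "jordan_part c \<mu> = variation_measure (Re_along c) \<mu>"
  unfolding jordan_part_def pos_variation_def variation_measure_def variation_Re_along[OF mu] ..

lemma space_sets_jordan_part [simp]:
  "space (jordan_part c \<mu>) = {0..}" "sets (jordan_part c \<mu>) = sets half_line"
proof -
  have *: "sets half_line \<subseteq> Pow {0..}" by (auto simp: sets_half_line)
  show "space (jordan_part c \<mu>) = {0..}"
    unfolding jordan_part_def pos_variation_def using * by (rule space_measure_of)
  have "sets (jordan_part c \<mu>) = sigma_sets {0..} (sets half_line)"
    unfolding jordan_part_def pos_variation_def using * by (rule sets_measure_of)
  also have "\<dots> = sets half_line"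
    using sets.sigma_sets_eq[of half_line] by (simp add: space_restrict_space)
  finally show "sets (jordan_part c \<mu>) = sets half_line" .
qed

lemma emeasure_jordan_part:
  assumes mu: "lf_complex_measure \<mu>" and A: "A \<in> sets half_line"
  shows "emeasure (jordan_part c \<mu>) A = (SUP B\<in>{B \<in> cpt_borel. B \<subseteq> A}. ennreal (Re_along c (\<mu> B)))"
  unfolding jordan_part_eq[OF mu] Re_gauge.emeasure_variation_measure[OF mu A]
  by (rule variation_Re_along[OF mu])

section \<open>Weights and local finiteness\<close>

lemma borel_measurable_half_line:
  "sets M = sets half_line \<Longrightarrow> continuous_on {0..} f \<Longrightarrow> f \<in> borel_measurable M"
  for f :: "real \<Rightarrow> 'b::topological_space"
  using borel_measurable_continuous_on_restrict[of "{0..}" f]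
  by (subst measurable_cong_sets[of _ half_line]) auto

lemma space_half_line [simp]: "space half_line = {0..}"
  by (simp add: space_restrict_space)

lemma space_eq_half_line: "sets M = sets half_line \<Longrightarrow> space M = {0..}"
  using sets_eq_imp_space_eq[of M half_line] by simp

lemma continuous_pos_lower_bound:
  fixes \<omega> :: "real \<Rightarrow> real"
  assumes "continuous_on {0..} \<omega>" "\<forall>t\<ge>0. 0 < \<omega> t"
  obtains m where "m > 0" "\<And>t. 0 \<le> t \<Longrightarrow> t \<le> b \<Longrightarrow> m \<le> \<omega> t"
proof (cases "0 \<le> b")
  case True
  have "continuous_on {0..b} \<omega>" by (rule continuous_on_subset[OF assms(1)]) auto
  then obtain x where "x \<in> {0..b}" "\<forall>t\<in>{0..b}. \<omega> x \<le> \<omega> t"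
    using continuous_attains_inf[of "{0..b}" \<omega>] True by fastforce
  then show thesis using that[of "\<omega> x"] assms(2) by auto
qed (use that[of 1] in auto)

text \<open>
  A weight is bounded below by a positive constant on each compact set.
\<close>

lemma weight_integrable_finite:
  assumes M: "sets M = sets half_line"
    and \<omega>: "continuous_on {0..} \<omega>" "\<forall>t\<ge>0. 0 < \<omega> t"
    and fin: "(\<integral>\<^sup>+t. ennreal (\<omega> t) \<partial>M) < \<infinity>"
    and A: "A \<in> cpt_borel"
  shows "emeasure M A < \<infinity>"
proof -
  have sA: "A \<in> sets M" using A M cpt_borelD by blast
  obtain b where b: "A \<subseteq> {0..b}" using A by (rule cpt_borel_obtain)
  obtain m where m: "m > 0" "\<And>t. 0 \<le> t \<Longrightarrow> t \<le> b \<Longrightarrow> m \<le> \<omega> t"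
    using continuous_pos_lower_bound[OF \<omega>] by metis
  have "ennreal m * emeasure M A = (\<integral>\<^sup>+t. ennreal m * indicator A t \<partial>M)"
    using sA by (simp add: nn_integral_cmult_indicator)
  also have "\<dots> \<le> (\<integral>\<^sup>+t. ennreal (\<omega> t) \<partial>M)"
    using m b by (intro nn_integral_mono) (auto split: split_indicator intro!: ennreal_leI)
  finally have "ennreal m * emeasure M A < top" using fin by (simp add: order_le_less_trans)
  then show ?thesis using m(1) by (auto simp: ennreal_mult_less_top)
qed

lemma sigma_finite_half_line:
  assumes M: "sets M = sets half_line" and fin: "\<And>n::nat. emeasure M {0..real n} < \<infinity>"
  shows "sigma_finite_measure M"
proof
  have "(\<Union>n. {0..real n}) = {0..}"
    using real_arch_simple by auto
  then show "\<exists>A. countable A \<and> A \<subseteq> sets M \<and> \<Union> A = space M \<and> (\<forall>a\<in>A. emeasure M a \<noteq> \<infinity>)"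
    using fin by (intro exI[of _ "range (\<lambda>n::nat. {0..real n})"])
      (auto simp: space_eq_half_line[OF M] M sets_half_line less_top)
qed

section \<open>The Jordan decomposition\<close>

lemma jordan_part_le_total_variation:
  assumes mu: "lf_complex_measure \<mu>" and c: "norm c = 1"
  shows "jordan_part c \<mu> \<le> total_variation \<mu>"
proof -
  have "emeasure (jordan_part c \<mu>) A \<le> emeasure (total_variation \<mu>) A" if A: "A \<in> sets half_line" for A
    unfolding emeasure_jordan_part[OF mu A] total_variation_eq norm_gauge.emeasure_variation_measure[OF mu A]
  proof (rule SUP_least)
    fix B assume B: "B \<in> {B \<in> cpt_borel. B \<subseteq> A}"
    have "Re_along c (\<mu> B) \<le> norm (\<mu> B)"
      unfolding Re_along_def using complex_Re_le_cmod[of "cnj c * \<mu> B"] c by (simp add: norm_mult)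
    then have "ennreal (Re_along c (\<mu> B)) \<le> ennreal (norm (\<mu> B))" by (rule ennreal_leI)
    also have "\<dots> \<le> variation norm \<mu> A" using B by (intro variation_upper1) auto
    finally show "ennreal (Re_along c (\<mu> B)) \<le> variation norm \<mu> A" .
  qed
  then show ?thesis
    by (subst le_measure) (auto simp: total_variation_eq)
qed

lemma Mw_jordan_part:
  assumes "\<mu> \<in> Mw \<omega>" "c \<in> units4"
  shows "(\<integral>\<^sup>+t. ennreal (\<omega> t) \<partial>jordan_part c \<mu>) < \<infinity>"
proof -
  have "(\<integral>\<^sup>+t. ennreal (\<omega> t) \<partial>jordan_part c \<mu>) \<le> (\<integral>\<^sup>+t. ennreal (\<omega> t) \<partial>total_variation \<mu>)"
    using assms by (intro nn_integral_mono_measure jordan_part_le_total_variation)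
      (auto simp: total_variation_eq Mw_def norm_units4)
  then show ?thesis using assms by (auto simp: Mw_def intro: order_le_less_trans)
qed

text \<open>
  For \<open>B \<subseteq> A\<close> additivity gives \<open>\<nu> B = \<nu> A + (- \<nu>) (A - B)\<close>, where \<open>\<nu>\<close> is the real part of \<open>\<mu>\<close>
  along \<open>c\<close>; taking suprema over \<open>B\<close> gives one inequality, and exchanging \<open>c\<close> and \<open>-c\<close> the other.
\<close>

lemma jordan_decomposition:
  assumes mu: "lf_complex_measure \<mu>" and A: "A \<in> cpt_borel"
    and fin: "emeasure (jordan_part c \<mu>) A < \<infinity>" "emeasure (jordan_part (-c) \<mu>) A < \<infinity>"
  shows "measure (jordan_part c \<mu>) A - measure (jordan_part (-c) \<mu>) A = Re_along c (\<mu> A)"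
proof -
  have sA: "A \<in> sets half_line" using A cpt_borelD by blast
  have le: "measure (jordan_part d \<mu>) A \<le> Re_along d (\<mu> A) + measure (jordan_part (-d) \<mu>) A"
    if fin: "emeasure (jordan_part d \<mu>) A < \<infinity>" "emeasure (jordan_part (-d) \<mu>) A < \<infinity>" for d
  proof -
    let ?r = "Re_along d (\<mu> A) + measure (jordan_part (-d) \<mu>) A"
    have bound: "Re_along d (\<mu> B) \<le> ?r" if B: "B \<in> cpt_borel" "B \<subseteq> A" for B
    proof -
      have AB: "A - B \<in> cpt_borel" using A B by (intro cpt_borel_Diff)
      have "\<mu> (B \<union> (A - B)) = \<mu> B + \<mu> (A - B)"
        by (rule lf_complex_measure_Un[OF mu]) (use B AB in auto)
      then have "\<mu> A = \<mu> B + \<mu> (A - B)" using B(2) by (simp add: Un_absorb1)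
      then have "Re_along d (\<mu> B) = Re_along d (\<mu> A) + Re_along (-d) (\<mu> (A - B))"
        by (simp add: Re_along_def algebra_simps)
      moreover have "ennreal (Re_along (-d) (\<mu> (A - B))) \<le> emeasure (jordan_part (-d) \<mu>) A"
        unfolding emeasure_jordan_part[OF mu sA] using AB by (intro SUP_upper) auto
      then have "Re_along (-d) (\<mu> (A - B)) \<le> measure (jordan_part (-d) \<mu>) A"
        using fin by (simp add: emeasure_eq_ennreal_measure less_top ennreal_le_iff)
      ultimately show ?thesis by simp
    qed
    have "?r \<ge> 0"
      using bound[of "{}"] lf_complex_measure_empty[OF mu] by (simp add: Re_along_def)
    have "emeasure (jordan_part d \<mu>) A \<le> ennreal ?r"
      unfolding emeasure_jordan_part[OF mu sA] by (intro SUP_least ennreal_leI bound) auto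
    then show ?thesis
      using \<open>?r \<ge> 0\<close> fin by (simp add: emeasure_eq_ennreal_measure less_top ennreal_le_iff)
  qed
  from le[of c] le[of "-c"] fin show ?thesis by (simp add: Re_along_def)
qed

lemma sum_jordan_part:
  assumes mu: "lf_complex_measure \<mu>" and A: "A \<in> cpt_borel"
    and fin: "\<And>c. c \<in> units4 \<Longrightarrow> emeasure (jordan_part c \<mu>) A < \<infinity>"
  shows "(\<Sum>c\<in>units4. c * complex_of_real (measure (jordan_part c \<mu>) A)) = \<mu> A"
proof -
  have "measure (jordan_part 1 \<mu>) A - measure (jordan_part (-1) \<mu>) A = Re (\<mu> A)"
      "measure (jordan_part \<i> \<mu>) A - measure (jordan_part (-\<i>) \<mu>) A = Im (\<mu> A)"
    using jordan_decomposition[OF mu A, of 1] jordan_decomposition[OF mu A, of \<i>] fin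
    by (auto simp: Re_along_def units4_def)
  then show ?thesis
    unfolding sum_units4 by (auto simp: complex_eq_iff)
qed

lemma cm_integral_indicator:
  assumes mu: "lf_complex_measure \<mu>" and A: "A \<in> cpt_borel"
    and fin: "\<And>c. c \<in> units4 \<Longrightarrow> emeasure (jordan_part c \<mu>) A < \<infinity>"
  shows "cm_integral \<mu> (indicator A) = \<mu> A"
proof -
  have "integral\<^sup>L (jordan_part c \<mu>) (indicator A) = complex_of_real (measure (jordan_part c \<mu>) A)" for c
  proof -
    have "A \<subseteq> {0..}" using A by (auto simp: cpt_borel_iff sets_half_line)
    then have "integral\<^sup>L (jordan_part c \<mu>) (\<lambda>t. complex_of_real (indicator A t)) = complex_of_real (measure (jordan_part c \<mu>) A)"
      by (subst integral_complex_of_real) (simp add: Int_absorb2)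
    also have "(\<lambda>t. complex_of_real (indicator A t)) = indicator A" by (auto split: split_indicator)
    finally show ?thesis .
  qed
  then show ?thesis
    unfolding cm_integral_eq using sum_jordan_part[OF mu A fin] by simp
qed

text \<open>
  Equal to 1 on $[0,b]$, then falling linearly to 0 within a distance of $1/n$. The values on the
  negative axis are 0 as in \<open>C0w\<close>.
\<close>

definition cutoff :: "real \<Rightarrow> nat \<Rightarrow> real \<Rightarrow> complex" where
  "cutoff b n t = (if t < 0 then 0 else of_real (max 0 (min 1 (1 - real n * (t - b)))))"

lemma cutoff_C0w:
  assumes "n > 0" shows "cutoff b n \<in> C0w \<omega>"
proof -
  have "continuous_on {0..} (\<lambda>t. complex_of_real (max 0 (min 1 (1 - real n * (t - b)))))"
    by (intro continuous_intros)
  then have "continuous_on {0..} (cutoff b n)"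
    by (rule continuous_on_eq) (auto simp: cutoff_def)
  moreover have "cutoff b n t = 0" if "t \<ge> b + 1" for t
  proof -
    have "1 * 1 \<le> real n * (t - b)" using that assms by (intro mult_mono) auto
    then show ?thesis by (simp add: cutoff_def)
  qed
  then have "eventually (\<lambda>t. cutoff b n t / complex_of_real (\<omega> t) = 0) at_top"
    by (intro eventually_mono[OF eventually_ge_at_top[of "b + 1"]]) simp
  then have "((\<lambda>t. cutoff b n t / complex_of_real (\<omega> t)) \<longlongrightarrow> 0) at_top"
    by (rule tendsto_eventually)
  ultimately show ?thesis by (auto simp: C0w_def cutoff_def)
qed

lemma cutoff_tendsto:
  assumes "b \<ge> 0" shows "(\<lambda>n. cutoff b (Suc n) t) \<longlonglongrightarrow> indicator {0..b} t"
proof (cases "t \<le> b")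
  case True
  then have "1 - (1 + real n) * (t - b) \<ge> 1" for n
    by (simp add: mult_nonneg_nonpos)
  then have "cutoff b (Suc n) t = indicator {0..b} t" for n
    using True by (auto simp: cutoff_def min_def)
  then show ?thesis by simp
next
  case False
  obtain N :: nat where N: "1 / (t - b) < real N" using reals_Archimedean2 by blast
  have "1 \<le> real (Suc n) * (t - b)" if "n \<ge> N" for n
  proof -
    have "1 / (t - b) \<le> real (Suc n)" using N that by linarith
    then show ?thesis using False by (simp add: pos_divide_le_eq)
  qed
  then have "eventually (\<lambda>n. 1 \<le> real (Suc n) * (t - b)) sequentially"
    by (rule eventually_sequentiallyI)
  then have "eventually (\<lambda>n. cutoff b (Suc n) t = indicator {0..b} t) sequentially"
    by (rule eventually_mono) (use False in \<open>auto simp: cutoff_def\<close>)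
  then show ?thesis by (rule tendsto_eventually)
qed

lemma cm_integral_cutoff_tendsto:
  assumes mu: "\<mu> \<in> Mw \<omega>" and \<omega>: "continuous_on {0..} \<omega>" "\<forall>t\<ge>0. 0 < \<omega> t" and b: "b \<ge> 0"
  shows "(\<lambda>n. cm_integral \<mu> (cutoff b (Suc n))) \<longlonglongrightarrow> \<mu> {0..b}"
proof -
  have fin: "emeasure (jordan_part c \<mu>) A < \<infinity>" if "c \<in> units4" "A \<in> cpt_borel" for c A
    using weight_integrable_finite[OF _ \<omega> Mw_jordan_part[OF mu]] that by auto
  have "(\<lambda>n. cm_integral \<mu> (cutoff b (Suc n))) \<longlonglongrightarrow> cm_integral \<mu> (indicator {0..b})"
    unfolding cm_integral_eq
  proof (intro tendsto_sum tendsto_mult_left integral_dominated_convergence[where w="indicator {0..b+1}"])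
    fix c assume c: "c \<in> units4"
    show "integrable (jordan_part c \<mu>) (indicator {0..b+1} :: real \<Rightarrow> real)"
      using fin[OF c, of "{0..b+1}"] b by (intro integrable_real_indicator) (auto simp: sets_half_line)
    show "cutoff b (Suc n) \<in> borel_measurable (jordan_part c \<mu>)" for n
      using cutoff_C0w[of "Suc n" b "\<lambda>_. 1"] by (intro borel_measurable_half_line) (auto simp: C0w_def)
    show "(indicator {0..b} :: real \<Rightarrow> complex) \<in> borel_measurable (jordan_part c \<mu>)"
      by (intro borel_measurable_indicator) (auto simp: sets_half_line)
    show "AE t in jordan_part c \<mu>. (\<lambda>n. cutoff b (Suc n) t) \<longlonglongrightarrow> indicator {0..b} t"
      using cutoff_tendsto[OF b] by simp
    show "AE t in jordan_part c \<mu>. norm (cutoff b (Suc n) t) \<le> indicator {0..b+1} t" for n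
    proof (rule AE_I2)
      fix t
      have "t > b + 1 \<Longrightarrow> 1 * 1 \<le> real (Suc n) * (t - b)" by (intro mult_mono) auto
      then show "norm (cutoff b (Suc n) t) \<le> indicator {0..b+1} t"
        by (auto simp: cutoff_def split: split_indicator)
    qed
  qed
  also have "cm_integral \<mu> (indicator {0..b}) = \<mu> {0..b}"
    using mu b by (intro cm_integral_indicator fin) (auto simp: Mw_def)
  finally show ?thesis .
qed

text \<open>
  Inside a fixed $[0,m]$, the Borel sets on which two measures agree form a Dynkin system that
  contains the intersection-stable family of half-lines.
\<close>

lemma lf_complex_measure_eqI:
  assumes mu: "lf_complex_measure \<mu>" and nu: "lf_complex_measure \<nu>"
    and eq: "\<And>b. b \<ge> 0 \<Longrightarrow> \<mu> {0..b} = \<nu> {0..b}"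
  shows "\<mu> = \<nu>"
proof
  fix A
  show "\<mu> A = \<nu> A"
  proof (cases "A \<in> cpt_borel")
    case False
    then show ?thesis using lf_complex_measureD(1) mu nu by metis
  next
    case True
    then obtain m where m: "m \<ge> 0" "A \<subseteq> {0..m}" by (rule cpt_borel_obtain)
    have cpt: "{0..m} \<inter> B \<in> cpt_borel" if "B \<in> sets borel" for B
      using that m(1) by (auto simp: cpt_borel_iff sets_half_line)
    have borel_eq: "sets borel = sigma_sets UNIV (range (\<lambda>a::real. {..a}))"
      by (subst borel_eq_atMost) simp
    have stable: "Int_stable (range (\<lambda>a::real. {..a}))" by (auto simp: Int_stable_def)
    have sub: "range (\<lambda>a::real. {..a}) \<subseteq> Pow UNIV" by auto
    have "\<mu> ({0..m} \<inter> B) = \<nu> ({0..m} \<inter> B)" if "B \<in> sigma_sets UNIV (range (\<lambda>a::real. {..a}))" for B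
      using stable sub that
    proof (induction B rule: sigma_sets_induct_disjoint)
      case (basic B)
      then obtain a where "B = {..a}" by auto
      then have *: "{0..m} \<inter> B = {0..min a m}" by auto
      have "\<mu> {0..min a m} = \<nu> {0..min a m}"
      proof (cases "min a m < 0")
        case True
        then have "{0..min a m} = {}" by simp
        then show ?thesis
          using lf_complex_measure_empty[OF mu] lf_complex_measure_empty[OF nu] by metis
      next
        case False
        then show ?thesis by (intro eq) linarith
      qed
      then show ?case by (simp only: *)
    next
      case empty
      then show ?case by (simp add: lf_complex_measure_empty[OF mu] lf_complex_measure_empty[OF nu])
    next
      case (compl B)
      have B: "B \<in> sets borel" using compl borel_eq by simp
      have "\<kappa> ({0..m} \<inter> (UNIV - B)) = \<kappa> {0..m} - \<kappa> ({0..m} \<inter> B)" if "lf_complex_measure \<kappa>" for \<kappa>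
      proof -
        have "\<kappa> (({0..m} \<inter> (UNIV - B)) \<union> ({0..m} \<inter> B)) = \<kappa> ({0..m} \<inter> (UNIV - B)) + \<kappa> ({0..m} \<inter> B)"
          by (rule lf_complex_measure_Un[OF that]) (use B cpt in auto)
        moreover have "({0..m} \<inter> (UNIV - B)) \<union> ({0..m} \<inter> B) = {0..m}" by blast
        ultimately show ?thesis by simp
      qed
      from this[OF mu] this[OF nu] show ?case using compl eq[OF m(1)] by metis
    next
      case (union B)
      have B: "B i \<in> sets borel" for i using union(2) borel_eq by auto
      have "(\<lambda>i. \<kappa> ({0..m} \<inter> B i)) sums \<kappa> (\<Union>i. {0..m} \<inter> B i)" if "lf_complex_measure \<kappa>" for \<kappa>
      proof (rule lf_complex_measureD(2)[OF that])
        show "range (\<lambda>i. {0..m} \<inter> B i) \<subseteq> cpt_borel" using cpt B by auto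
        show "disjoint_family (\<lambda>i. {0..m} \<inter> B i)" using union(1) by (auto simp: disjoint_family_on_def)
        have "(\<Union>i. {0..m} \<inter> B i) = {0..m} \<inter> (\<Union>i. B i)" by blast
        then show "(\<Union>i. {0..m} \<inter> B i) \<in> cpt_borel" using cpt B by simp
      qed
      from this[OF mu] this[OF nu]
      have "(\<lambda>i. \<nu> ({0..m} \<inter> B i)) sums \<mu> (\<Union>i. {0..m} \<inter> B i)"
        "(\<lambda>i. \<nu> ({0..m} \<inter> B i)) sums \<nu> (\<Union>i. {0..m} \<inter> B i)"
        by (simp_all only: union(3))
      then have "\<mu> (\<Union>i. {0..m} \<inter> B i) = \<nu> (\<Union>i. {0..m} \<inter> B i)" by (rule sums_unique2)
      then show ?case by (simp only: Int_UN_distrib)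
    qed
    from this[of A] True m show ?thesis
      by (simp add: Int_absorb1 cpt_borel_iff sets_half_line borel_eq)
  qed
qed

text \<open>
  The cutoffs decrease to the indicator function of $[0,b]$, so the integrals determine the
  values on these intervals.
\<close>

lemma Mw_eqI:
  assumes mu: "\<mu> \<in> Mw \<omega>" "\<nu> \<in> Mw \<omega>" and \<omega>: "continuous_on {0..} \<omega>" "\<forall>t\<ge>0. 0 < \<omega> t"
    and eq: "\<And>g. g \<in> C0w \<omega> \<Longrightarrow> cm_integral \<mu> g = cm_integral \<nu> g"
  shows "\<mu> = \<nu>"
proof (rule lf_complex_measure_eqI)
  fix b :: real assume b: "b \<ge> 0"
  have "(\<lambda>n. cm_integral \<mu> (cutoff b (Suc n))) \<longlonglongrightarrow> \<nu> {0..b}"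
    using cm_integral_cutoff_tendsto[OF mu(2) \<omega> b] by (simp add: eq cutoff_C0w)
  then show "\<mu> {0..b} = \<nu> {0..b}"
    using cm_integral_cutoff_tendsto[OF mu(1) \<omega> b] LIMSEQ_unique by blast
qed (use mu in \<open>auto simp: Mw_def\<close>)

section \<open>Complex measures with a density\<close>

definition density_cm :: "real measure \<Rightarrow> (real \<Rightarrow> complex) \<Rightarrow> real set \<Rightarrow> complex" where
  "density_cm M h A = (if A \<in> cpt_borel then (LINT t:A|M. h t) else 0)"

locale locally_integrable_density =
  fixes M :: "real measure" and h :: "real \<Rightarrow> complex"
  assumes sets_M: "sets M = sets half_line"
    and h [measurable]: "h \<in> borel_measurable M"
    and loc_fin: "\<And>b. (\<integral>\<^sup>+t\<in>{0..b}. ennreal (norm (h t)) \<partial>M) < \<infinity>"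
begin

lemma set_integrable_cpt:
  assumes A: "A \<in> cpt_borel" shows "set_integrable M A h"
proof -
  obtain b where b: "A \<subseteq> {0..b}" using A by (rule cpt_borel_obtain)
  have "set_integrable M {0..b} h"
    unfolding set_integrable_def
  proof (rule integrableI_bounded)
    have "{0..b} \<in> sets M" by (simp add: sets_M sets_half_line)
    then show "(\<lambda>t. indicator {0..b} t *\<^sub>R h t) \<in> borel_measurable M" by measurable
    have "(\<integral>\<^sup>+t. ennreal (norm (indicator {0..b} t *\<^sub>R h t)) \<partial>M) = (\<integral>\<^sup>+t\<in>{0..b}. ennreal (norm (h t)) \<partial>M)"
      by (intro nn_integral_cong) (auto split: split_indicator)
    then show "(\<integral>\<^sup>+t. ennreal (norm (indicator {0..b} t *\<^sub>R h t)) \<partial>M) < \<infinity>"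
      using loc_fin by simp
  qed
  then show ?thesis
    by (rule set_integrable_subset) (use A b cpt_borelD sets_M in auto)
qed

lemma lf_complex_measure_density: "lf_complex_measure (density_cm M h)"
  unfolding lf_complex_measure_def
proof (intro conjI allI impI)
  fix E :: "nat \<Rightarrow> real set"
  assume E: "range E \<subseteq> cpt_borel" "disjoint_family E" "(\<Union>i. E i) \<in> cpt_borel"
  have sE: "E i \<in> sets M" for i using E(1) cpt_borelD sets_M by blast
  have "(\<Sum>i<n. density_cm M h (E i)) = (LINT t:(\<Union>i<n. E i)|M. h t)" for n
  proof -
    have "(LINT t:(\<Union>i<n. E i)|M. h t) = (\<Sum>i<n. LINT t:E i|M. h t)"
      using E sE by (intro set_integral_finite_Union set_integrable_cpt)
        (auto simp: disjoint_family_on_def)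
    also have "\<dots> = (\<Sum>i<n. density_cm M h (E i))"
      using E(1) by (intro sum.cong) (auto simp: density_cm_def)
    finally show ?thesis ..
  qed
  moreover have "(\<lambda>n. LINT t:(\<Union>i<n. E i)|M. h t) \<longlonglongrightarrow> (LINT t:(\<Union>n. \<Union>i<n. E i)|M. h t)"
  proof (rule set_integral_cont_up)
    have "(\<Union>n. \<Union>i<n. E i) = (\<Union>i. E i)" by auto
    then show "set_integrable M (\<Union>n. \<Union>i<n. E i) h" using set_integrable_cpt[OF E(3)] by simp
    show "incseq (\<lambda>n. \<Union>i<n. E i)" by (force simp: incseq_def)
  qed (use sE in auto)
  moreover have "(\<Union>n. \<Union>i<n. E i) = (\<Union>i. E i)" by auto
  ultimately show "(\<lambda>i. density_cm M h (E i)) sums density_cm M h (\<Union>i. E i)"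
    using E(3) by (simp add: sums_def density_cm_def)
qed (simp add: density_cm_def)

lemma total_variation_density_le: "total_variation (density_cm M h) \<le> density M (\<lambda>t. ennreal (norm (h t)))"
proof -
  have "variation norm (density_cm M h) A \<le> emeasure (density M (\<lambda>t. ennreal (norm (h t)))) A"
    if A: "A \<in> sets half_line" for A
    unfolding variation_def
  proof (rule SUP_least)
    fix P assume P: "P \<in> cpt_families A"
    let ?N = "density M (\<lambda>t. ennreal (norm (h t)))"
    have PM: "P \<subseteq> sets M" using P cpt_borelD sets_M by (auto simp: cpt_families_def)
    have "(\<Sum>E\<in>P. ennreal (norm (density_cm M h E))) \<le> (\<Sum>E\<in>P. emeasure ?N E)"
    proof (rule sum_mono)
      fix E assume "E \<in> P"
      then have E: "E \<in> cpt_borel" "E \<in> sets M" using P PM by (auto simp: cpt_families_def)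
      have "ennreal (norm (LINT t:E|M. h t)) \<le> (\<integral>\<^sup>+t. ennreal (norm (indicator E t *\<^sub>R h t)) \<partial>M)"
        using set_integrable_cpt[OF E(1)] unfolding set_integrable_def set_lebesgue_integral_def
        by (rule integral_norm_bound_ennreal)
      also have "\<dots> = (\<integral>\<^sup>+t. ennreal (norm (h t)) * indicator E t \<partial>M)"
        by (intro nn_integral_cong) (auto split: split_indicator)
      also have "\<dots> = emeasure ?N E" using E by (simp add: emeasure_density)
      finally show "ennreal (norm (density_cm M h E)) \<le> emeasure ?N E"
        using E by (simp add: density_cm_def)
    qed
    also have "\<dots> = emeasure ?N (\<Union>E\<in>P. E)"
      using P PM by (intro sum_emeasure)
        (auto simp: cpt_families_def disjoint_family_on_def disjoint_def)
    also have "\<dots> \<le> emeasure ?N A"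
      using P A by (intro emeasure_mono) (auto simp: cpt_families_def sets_M)
    finally show "(\<Sum>E\<in>P. ennreal (norm (density_cm M h E))) \<le> emeasure ?N A" .
  qed
  then show ?thesis
    by (subst le_measure)
      (auto simp: total_variation_eq sets_M
         norm_gauge.emeasure_variation_measure[OF lf_complex_measure_density])
qed

lemma integrable_Re_along:
  assumes B: "B \<in> cpt_borel"
  shows "integrable M (\<lambda>t. indicator B t *\<^sub>R Re_along c (h t))"
proof -
  have int: "integrable M (\<lambda>t. indicator B t *\<^sub>R h t)"
    using set_integrable_cpt[OF B] by (simp add: set_integrable_def)
  from integrable_bounded_linear[OF bounded_linear_Re_along int] show ?thesis
    by (rule back_subst[of "integrable M"]) (auto simp: Re_along_def split: split_indicator)
qed

lemma Re_along_set_integral: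
  assumes B: "B \<in> cpt_borel"
  shows "Re_along c (density_cm M h B) = (LINT t:B|M. Re_along c (h t))"
proof -
  have int: "integrable M (\<lambda>t. indicator B t *\<^sub>R h t)"
    using set_integrable_cpt[OF B] by (simp add: set_integrable_def)
  from integral_bounded_linear[OF bounded_linear_Re_along int]
  have "Re_along c (LINT t:B|M. h t) = (\<integral>t. Re_along c (indicator B t *\<^sub>R h t) \<partial>M)"
    by (simp add: set_lebesgue_integral_def)
  also have "\<dots> = (LINT t:B|M. Re_along c (h t))"
    unfolding set_lebesgue_integral_def
    by (intro Bochner_Integration.integral_cong) (auto simp: Re_along_def split: split_indicator)
  finally show ?thesis using B by (simp add: density_cm_def)
qed

lemma Re_along_measurable [measurable]: "(\<lambda>t. Re_along c (h t)) \<in> borel_measurable M"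
  unfolding Re_along_def by measurable

text \<open>
  The inequality in \<open>jordan_part_density\<close> that holds for every subset; \<open>ennreal\<close> replaces the
  density by its positive part.
\<close>

lemma Re_along_le_emeasure:
  assumes B: "B \<in> cpt_borel" "B \<subseteq> A" and A: "A \<in> sets half_line"
  shows "ennreal (Re_along c (density_cm M h B)) \<le> emeasure (density M (\<lambda>t. ennreal (Re_along c (h t)))) A"
proof -
  note int' = integrable_Re_along[OF B(1), of c]
  have int'': "integrable M (\<lambda>t. max 0 (indicator B t *\<^sub>R Re_along c (h t)))"
    using int' by (intro Bochner_Integration.integrable_max) auto
  have "ennreal (Re_along c (density_cm M h B)) \<le> ennreal (\<integral>t. max 0 (indicator B t *\<^sub>R Re_along c (h t)) \<partial>M)"
    unfolding Re_along_set_integral[OF B(1)] set_lebesgue_integral_def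
    by (intro ennreal_leI integral_mono int' int'') auto
  also have "\<dots> = (\<integral>\<^sup>+t. ennreal (max 0 (indicator B t *\<^sub>R Re_along c (h t))) \<partial>M)"
    by (rule nn_integral_eq_integral[symmetric, OF int'']) auto
  also have "\<dots> \<le> (\<integral>\<^sup>+t. ennreal (Re_along c (h t)) * indicator A t \<partial>M)"
    using B(2) by (intro nn_integral_mono) (auto split: split_indicator simp: max_def)
  also have "\<dots> = emeasure (density M (\<lambda>t. ennreal (Re_along c (h t)))) A"
    using A by (intro emeasure_density[symmetric]) (auto simp: sets_M)
  finally show ?thesis .
qed

text \<open>
  The supremum over subsets \<open>B\<close> of \<open>A\<close> is approached by the sets on which the density is
  nonnegative; they are truncated to $[0,n]$ because only bounded sets are admitted.
\<close>

lemma jordan_part_density: "jordan_part c (density_cm M h) = density M (\<lambda>t. ennreal (Re_along c (h t)))"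
    (is "_ = ?N")
proof (rule measure_eqI)
  fix A assume "A \<in> sets (jordan_part c (density_cm M h))"
  then have A: "A \<in> sets half_line" by simp
  define B where "B n = A \<inter> {0..real n} \<inter> {t \<in> space M. 0 \<le> Re_along c (h t)}" for n :: nat
  have pos: "{t \<in> space M. 0 \<le> Re_along c (h t)} \<in> sets half_line"
    by (subst sets_M[symmetric]) measurable
  have Bc: "B n \<in> cpt_borel" "B n \<subseteq> A" "B n \<in> sets M" for n
  proof -
    have "{0..real n} \<inter> (A \<inter> {t \<in> space M. 0 \<le> Re_along c (h t)}) \<in> cpt_borel"
      using A pos by (intro cpt_borel_Int) auto
    also have "{0..real n} \<inter> (A \<inter> {t \<in> space M. 0 \<le> Re_along c (h t)}) = B n"
      by (auto simp: B_def)
    finally show "B n \<in> cpt_borel" .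
    then show "B n \<in> sets M" using cpt_borelD sets_M by blast
  qed (auto simp: B_def)
  have "emeasure ?N (B n) = ennreal (Re_along c (density_cm M h (B n)))" for n
  proof -
    have "emeasure ?N (B n) = (\<integral>\<^sup>+t. ennreal (indicator (B n) t *\<^sub>R Re_along c (h t)) \<partial>M)"
      using Bc(3) by (subst emeasure_density) (auto intro!: nn_integral_cong split: split_indicator)
    also have "\<dots> = ennreal (\<integral>t. indicator (B n) t *\<^sub>R Re_along c (h t) \<partial>M)"
      by (rule nn_integral_eq_integral[OF integrable_Re_along[OF Bc(1)]]) (auto simp: B_def split: split_indicator)
    finally show ?thesis
      unfolding Re_along_set_integral[OF Bc(1)] set_lebesgue_integral_def .
  qed
  moreover have "(\<lambda>n. emeasure ?N (B n)) \<longlonglongrightarrow> emeasure ?N (\<Union>n. B n)"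
    by (rule Lim_emeasure_incseq) (use Bc in \<open>auto simp: incseq_def B_def\<close>)
  moreover have "emeasure ?N (\<Union>n. B n) = emeasure ?N A"
  proof -
    have "(\<Union>n. B n) = A \<inter> {t \<in> space M. 0 \<le> Re_along c (h t)}"
      using A real_arch_simple by (auto simp: B_def sets_half_line subset_iff)
    moreover have "A \<inter> {t \<in> space M. 0 \<le> Re_along c (h t)} \<in> sets M"
      using A pos sets_M by auto
    moreover have "A \<subseteq> space M" using A sets.sets_into_space sets_M by metis
    ultimately show ?thesis
      using A sets_M by (auto simp: emeasure_density ennreal_eq_0_iff intro!: nn_integral_cong split: split_indicator)
  qed
  ultimately have "(\<lambda>n. ennreal (Re_along c (density_cm M h (B n)))) \<longlonglongrightarrow> emeasure ?N A" by simp
  then have "emeasure ?N A \<le> emeasure (jordan_part c (density_cm M h)) A"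
    unfolding emeasure_jordan_part[OF lf_complex_measure_density A]
    by (rule LIMSEQ_le_const2) (use Bc in \<open>intro exI allI impI SUP_upper; simp\<close>)
  moreover have "emeasure (jordan_part c (density_cm M h)) A \<le> emeasure ?N A"
    unfolding emeasure_jordan_part[OF lf_complex_measure_density A]
    using Re_along_le_emeasure A by (intro SUP_least) auto
  ultimately show "emeasure (jordan_part c (density_cm M h)) A = emeasure ?N A" by (rule antisym[rotated])
qed (simp add: sets_M)

lemma sum_units4_Re_along: "(\<Sum>c\<in>units4. c * of_real (max 0 (Re_along c z))) = z"
  unfolding sum_units4 Re_along_def by (auto simp: complex_eq_iff max_def)

lemma cm_integral_density:
  assumes g: "g \<in> borel_measurable M" and int: "integrable M (\<lambda>t. h t * g t)"
  shows "cm_integral (density_cm M h) g = (\<integral>t. h t * g t \<partial>M)"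
proof -
  have part: "integral\<^sup>L (jordan_part c (density_cm M h)) g = (\<integral>t. of_real (max 0 (Re_along c (h t))) * g t \<partial>M)" for c
  proof -
    have "integral\<^sup>L (jordan_part c (density_cm M h)) g = integral\<^sup>L (density M (\<lambda>t. ennreal (max 0 (Re_along c (h t))))) g"
      unfolding jordan_part_density by (simp add: ennreal_max_0)
    also have "\<dots> = (\<integral>t. max 0 (Re_along c (h t)) *\<^sub>R g t \<partial>M)"
      using g by (intro integral_density) auto
    finally show ?thesis by (simp add: scaleR_conv_of_real)
  qed
  have intc: "integrable M (\<lambda>t. of_real (max 0 (Re_along c (h t))) * g t)" if "c \<in> units4" for c
  proof (rule Bochner_Integration.integrable_bound[OF int])
    show "(\<lambda>t. of_real (max 0 (Re_along c (h t))) * g t) \<in> borel_measurable M"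
      using g by measurable
    have "\<bar>max 0 (Re_along c (h t))\<bar> \<le> norm (h t)" for t
      unfolding Re_along_def using complex_Re_le_cmod[of "cnj c * h t"] norm_units4[OF that]
      by (simp add: norm_mult)
    then show "AE t in M. norm (of_real (max 0 (Re_along c (h t))) * g t) \<le> norm (h t * g t)"
      by (auto simp: norm_mult intro!: mult_right_mono)
  qed
  have "cm_integral (density_cm M h) g = (\<integral>t. (\<Sum>c\<in>units4. c * (of_real (max 0 (Re_along c (h t))) * g t)) \<partial>M)"
    unfolding cm_integral_eq part using intc by (subst Bochner_Integration.integral_sum) auto
  also have "\<dots> = (\<integral>t. h t * g t \<partial>M)"
    by (subst (2) sum_units4_Re_along[symmetric])
      (simp only: sum_distrib_right mult.assoc)
  finally show ?thesis .
qed

lemma density_in_Mw: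
  assumes "continuous_on {0..} \<omega>" and "(\<integral>\<^sup>+t. ennreal (norm (h t) * \<omega> t) \<partial>M) < \<infinity>"
  shows "density_cm M h \<in> Mw \<omega>"
proof -
  have m: "\<omega> \<in> borel_measurable M" by (rule borel_measurable_half_line[OF sets_M assms(1)])
  have "(\<integral>\<^sup>+t. ennreal (\<omega> t) \<partial>total_variation (density_cm M h)) \<le> (\<integral>\<^sup>+t. ennreal (\<omega> t) \<partial>density M (\<lambda>t. ennreal (norm (h t))))"
    by (intro nn_integral_mono_measure total_variation_density_le) (simp add: total_variation_eq sets_M)
  also have "\<dots> = (\<integral>\<^sup>+t. ennreal (norm (h t) * \<omega> t) \<partial>M)"
    using m by (subst nn_integral_density) (auto simp: ennreal_mult')
  finally show ?thesis
    using assms(2) lf_complex_measure_density by (simp add: Mw_def order_le_less_trans)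
qed

end

section \<open>Lebesgue measure together with a unit mass at the origin\<close>

text \<open>
  The map \<open>max 0\<close> collapses the interval $(-1,0]$ of length 1 to the origin and fixes the other
  points, so the image measure is Lebesgue measure on the half-line plus \<open>delta0\<close>. With respect to
  it, a sum of an absolutely continuous measure and a multiple of \<open>delta0\<close> has a density, and
  \<open>cm_integral_density\<close> applies to the sum as a whole.
\<close>

definition lborel_delta :: "real measure" where
  "lborel_delta = distr (restrict_space lborel {-1<..}) half_line (max 0)"

lemma sets_lborel_delta [simp, measurable_cong]: "sets lborel_delta = sets half_line"
  by (simp add: lborel_delta_def)

lemma max_0_measurable: "max 0 \<in> restrict_space lborel {-1<..} \<rightarrow>\<^sub>M half_line"
  by (intro measurable_restrict_space2 measurable_restrict_space1) auto

lemma nn_integral_lborel_delta: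
  fixes F :: "real \<Rightarrow> ennreal"
  assumes F: "F \<in> borel_measurable half_line"
  shows "(\<integral>\<^sup>+t. F t \<partial>lborel_delta) = (\<integral>\<^sup>+t\<in>{0..}. F t \<partial>lborel) + F 0"
proof -
  have F': "(\<lambda>t. F t * indicator {0..} t) \<in> borel_measurable lborel"
    using F by (simp add: borel_measurable_restrict_space_iff_ennreal)
  have *: "(\<lambda>t. F (max 0 t)) \<in> borel_measurable (restrict_space lborel {-1<..})"
    using measurable_compose[OF max_0_measurable F] .
  have "(\<integral>\<^sup>+t. F t \<partial>lborel_delta) = (\<integral>\<^sup>+t. F (max 0 t) \<partial>restrict_space lborel {-1<..})"
    unfolding lborel_delta_def using F by (subst nn_integral_distr[OF max_0_measurable]) auto
  also have "\<dots> = (\<integral>\<^sup>+t. F (max 0 t) * indicator {-1<..} t \<partial>lborel)"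
    by (subst nn_integral_restrict_space) auto
  also have "\<dots> = (\<integral>\<^sup>+t. F t * indicator {0..} t + F 0 * indicator {-1<..<0} t \<partial>lborel)"
    by (intro nn_integral_cong) (auto split: split_indicator simp: max_def)
  also have "\<dots> = (\<integral>\<^sup>+t\<in>{0..}. F t \<partial>lborel) + F 0"
    using F' by (subst nn_integral_add) (auto simp: nn_integral_cmult_indicator)
  finally show ?thesis .
qed

lemma integral_lborel_delta:
  fixes F :: "real \<Rightarrow> complex"
  assumes F: "set_borel_measurable lborel {0..} F" and int: "set_integrable lborel {0..} F"
  shows "integral\<^sup>L lborel_delta F = (LINT t:{0..}|lborel. F t) + F 0"
proof -
  have F1: "F \<in> borel_measurable half_line"
    using F by (simp add: borel_measurable_restrict_space_iff set_borel_measurable_def)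
  have "integral\<^sup>L lborel_delta F = (\<integral>t. F (max 0 t) \<partial>restrict_space lborel {-1<..})"
    unfolding lborel_delta_def using max_0_measurable F1 by (rule integral_distr)
  also have "\<dots> = (\<integral>t. indicator {-1<..} t *\<^sub>R F (max 0 t) \<partial>lborel)"
    by (subst integral_restrict_space) auto
  also have "\<dots> = (\<integral>t. indicator {0..} t *\<^sub>R F t + indicator {-1<..<0} t *\<^sub>R F 0 \<partial>lborel)"
    by (intro Bochner_Integration.integral_cong) (auto split: split_indicator simp: max_def)
  also have "\<dots> = (LINT t:{0..}|lborel. F t) + F 0"
    using int unfolding set_integrable_def set_lebesgue_integral_def
    by (subst Bochner_Integration.integral_add) (auto simp: integrable_real_indicator)
  finally show ?thesis .
qed

section \<open>The substitution t = s / x\<close>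

text \<open>
  Substitution in integrals over compact intervals gives the equality on subsets of $[1/n,1]$,
  and continuity from below gives the rest.
\<close>

lemma lborel_inversion:
  fixes s :: real
  assumes s: "s > 0"
  shows "density lborel (indicator {0<..1}) =
    distr (density lborel (\<lambda>x. ennreal (s / x\<^sup>2) * indicator {s..} x)) borel (\<lambda>x. s / x)"
    (is "?N = ?D")
proof (rule measure_eqI)
  fix B assume "B \<in> sets ?N"
  then have B [measurable]: "B \<in> sets borel" by simp
  define J where "J n = {1 / real (Suc n)..1}" for n
  have J [measurable]: "J n \<in> sets borel" for n by (simp add: J_def)
  have eq: "emeasure ?N (B \<inter> J n) = emeasure ?D (B \<inter> J n)" for n
  proof -
    let ?b = "s * real (Suc n)"
    \<comment> \<open>Negation makes the substitution increasing.\<close>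
    define g where "g x = - (s / x)" for x
    define f :: "real \<Rightarrow> real" where "f u = indicator B (- u)" for u
    have gs: "g s = -1" "g ?b = - (1 / real (Suc n))" using s by (simp_all add: g_def)
    have fm [measurable]: "f \<in> borel_measurable borel"
      unfolding f_def using B by measurable
    have "emeasure ?N (B \<inter> J n) = (\<integral>\<^sup>+u. indicator {0<..1} u * indicator (B \<inter> J n) u \<partial>lborel)"
      by (subst emeasure_density) auto
    also have "\<dots> = (\<integral>\<^sup>+u. ennreal (f (- u) * indicator {g s..g ?b} (- u)) \<partial>lborel)"
    proof (rule nn_integral_cong)
      fix u
      have "0 < 1 / real (Suc n)" by simp
      then have "0 < u" if "1 / real (Suc n) \<le> u" using that by (rule less_le_trans)
      then show "indicator {0<..1} u * indicator (B \<inter> J n) u = ennreal (f (- u) * indicator {g s..g ?b} (- u))"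
        unfolding gs f_def J_def by (auto split: split_indicator)
    qed
    also have "\<dots> = (\<integral>\<^sup>+u. ennreal (f u * indicator {g s..g ?b} u) \<partial>lborel)"
      by (subst (2) nn_integral_real_affine[where c="-1" and t=0]) auto
    also have "\<dots> = (\<integral>\<^sup>+x. ennreal (f (g x) * (s / x\<^sup>2) * indicator {s..?b} x) \<partial>lborel)"
    proof (rule nn_integral_substitution)
      show "set_borel_measurable borel {g s..g ?b} f"
        unfolding set_borel_measurable_def by measurable
      show "(g has_real_derivative s / x\<^sup>2) (at x)" if "x \<in> {s..?b}" for x
        unfolding g_def using that s
        by (auto intro!: derivative_eq_intros simp: power2_eq_square)
      show "continuous_on {s..?b} (\<lambda>x. s / x\<^sup>2)"
        using s by (intro continuous_intros) auto
    qed (use s in \<open>auto simp: algebra_simps\<close>)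
    also have "\<dots> = (\<integral>\<^sup>+x. (ennreal (s / x\<^sup>2) * indicator {s..} x) * indicator (B \<inter> J n) (s / x) \<partial>lborel)"
    proof (rule nn_integral_cong)
      fix x
      have "s \<le> x \<Longrightarrow> s / x \<in> J n \<longleftrightarrow> x \<le> ?b"
        using s by (auto simp: J_def field_simps)
      then show "ennreal (f (g x) * (s / x\<^sup>2) * indicator {s..?b} x) =
          (ennreal (s / x\<^sup>2) * indicator {s..} x) * indicator (B \<inter> J n) (s / x)"
        unfolding f_def g_def by (auto split: split_indicator)
    qed
    also have "\<dots> = emeasure ?D (B \<inter> J n)"
    proof -
      have "(\<lambda>x. s / x) -` (B \<inter> J n) \<in> sets borel"
        using measurable_sets[of "\<lambda>x::real. s / x" borel borel "B \<inter> J n"] by simp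
      then have "emeasure ?D (B \<inter> J n) = (\<integral>\<^sup>+x. (ennreal (s / x\<^sup>2) * indicator {s..} x) * indicator ((\<lambda>x. s / x) -` (B \<inter> J n)) x \<partial>lborel)"
        by (subst emeasure_distr) (auto simp: emeasure_density)
      then show ?thesis by (simp only: indicator_vimage)
    qed
    finally show ?thesis .
  qed
  have lim: "(\<lambda>n. emeasure M (B \<inter> J n)) \<longlonglongrightarrow> emeasure M (B \<inter> {0<..1})" if M: "sets M = sets borel" for M
  proof -
    have U: "(\<Union>n. B \<inter> J n) = B \<inter> {0<..1}"
    proof -
      have 1: "x \<in> (\<Union>n. J n)" if "x \<in> {0<..1}" for x
      proof -
        have "0 < x" using that by simp
        from reals_Archimedean[OF this] obtain n where "inverse (real (Suc n)) < x" ..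
        then have "x \<in> J n" using that by (simp add: J_def inverse_eq_divide)
        then show ?thesis by blast
      qed
      have 2: "x \<in> {0<..1}" if "x \<in> J n" for x n
      proof -
        have "0 < 1 / real (Suc n)" by simp
        also have "\<dots> \<le> x" using that by (simp add: J_def)
        finally show ?thesis using that by (simp add: J_def)
      qed
      show ?thesis using 1 2 by blast
    qed
    have "incseq J"
    proof (rule incseq_SucI)
      fix n
      have "1 / real (Suc (Suc n)) \<le> 1 / real (Suc n)" by (intro divide_left_mono) auto
      then show "J n \<subseteq> J (Suc n)" unfolding J_def by (intro atLeastatMost_subset_iff[THEN iffD2]) simp
    qed
    then have "(\<lambda>n. emeasure M (B \<inter> J n)) \<longlonglongrightarrow> emeasure M (\<Union>n. B \<inter> J n)"
      by (intro Lim_emeasure_incseq) (use M B J in \<open>auto simp: incseq_def\<close>)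
    then show ?thesis unfolding U .
  qed
  have "(\<lambda>n. emeasure ?N (B \<inter> J n)) \<longlonglongrightarrow> emeasure ?D (B \<inter> {0<..1})"
    unfolding eq by (rule lim) simp
  with lim[of ?N] have "emeasure ?N (B \<inter> {0<..1}) = emeasure ?D (B \<inter> {0<..1})"
    using LIMSEQ_unique by fastforce
  moreover have "emeasure ?N (B \<inter> {0<..1}) = emeasure ?N B"
    by (auto simp: emeasure_density intro!: nn_integral_cong split: split_indicator)
  moreover have "emeasure ?D (B \<inter> {0<..1}) = emeasure ?D B"
  proof -
    have *: "(\<lambda>x. s / x) -` B' \<in> sets borel" if "B' \<in> sets borel" for B'
      using that measurable_sets[of "\<lambda>x::real. s / x" borel borel B'] by simp
    have **: "s \<le> x \<Longrightarrow> 0 < s / x \<and> s / x \<le> 1" for x using s by (auto simp: field_simps)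
    show ?thesis
      by (subst (1 2) emeasure_distr)
        (use ** in \<open>auto simp: emeasure_density * intro!: nn_integral_cong split: split_indicator\<close>)
  qed
  ultimately show "emeasure ?N B = emeasure ?D B" by simp
qed simp

lemma nn_integral_inversion:
  fixes G :: "real \<Rightarrow> ennreal"
  assumes s: "s > 0" and G [measurable]: "G \<in> borel_measurable borel"
  shows "(\<integral>\<^sup>+t\<in>{0<..1}. G t \<partial>lborel) = (\<integral>\<^sup>+x\<in>{s..}. ennreal (s / x\<^sup>2) * G (s / x) \<partial>lborel)"
proof -
  have "(\<integral>\<^sup>+t\<in>{0<..1}. G t \<partial>lborel) = (\<integral>\<^sup>+t. G t \<partial>density lborel (indicator {0<..1}))"
    by (subst nn_integral_density) (auto intro!: nn_integral_cong simp: mult.commute)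
  also have "\<dots> = (\<integral>\<^sup>+x\<in>{s..}. ennreal (s / x\<^sup>2) * G (s / x) \<partial>lborel)"
    unfolding lborel_inversion[OF s]
    by (simp add: nn_integral_distr nn_integral_density mult_ac)
  finally show ?thesis .
qed

lemma integral_inversion:
  fixes G :: "real \<Rightarrow> complex"
  assumes s: "s > 0" and G [measurable]: "G \<in> borel_measurable borel"
  shows "(LINT t:{0<..1}|lborel. G t) = (LINT x:{s..}|lborel. of_real (s / x\<^sup>2) * G (s / x))"
proof -
  have "(LINT t:{0<..1}|lborel. G t) = (\<integral>t. G t \<partial>density lborel (\<lambda>t. ennreal (indicator {0<..1} t)))"
    unfolding set_lebesgue_integral_def by (subst integral_density) auto
  also have "density lborel (\<lambda>t. ennreal (indicator {0<..1} t)) = density lborel (indicator {0<..1::real})"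
    by (simp add: ennreal_indicator)
  also have "(\<integral>t. G t \<partial>density lborel (indicator {0<..1})) =
      (\<integral>x. G (s / x) \<partial>density lborel (\<lambda>x. ennreal (s / x\<^sup>2) * indicator {s..} x))"
    unfolding lborel_inversion[OF s] by (rule integral_distr) auto
  also have "(\<lambda>x. ennreal (s / x\<^sup>2) * indicator {s..} x) = (\<lambda>x. ennreal (s / x\<^sup>2 * indicator {s..} x))"
    by (auto split: split_indicator)
  also have "(\<integral>x. G (s / x) \<partial>density lborel (\<lambda>x. ennreal (s / x\<^sup>2 * indicator {s..} x))) =
      (LINT x:{s..}|lborel. of_real (s / x\<^sup>2) * G (s / x))"
    unfolding set_lebesgue_integral_def using s
    by (subst integral_density)
      (auto simp: scaleR_conv_of_real intro!: Bochner_Integration.integral_cong split: split_indicator)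
  finally show ?thesis .
qed

section \<open>The kernel and the adjoint operator\<close>

lemma C0w_measurable:
  assumes "g \<in> C0w \<omega>" shows "g \<in> borel_measurable borel"
proof -
  have "continuous_on UNIV (g \<circ> max 0)"
    using assms by (intro continuous_on_compose) (auto simp: C0w_def intro!: continuous_intros elim: continuous_on_subset)
  then have [measurable]: "g \<circ> max 0 \<in> borel_measurable borel"
    by (rule borel_measurable_continuous_onI)
  have "g = (\<lambda>x. if 0 \<le> x then (g \<circ> max 0) x else 0)"
    using assms by (auto simp: C0w_def)
  also have "\<dots> \<in> borel_measurable borel" by measurable
  finally show ?thesis .
qed

text \<open>
  Only the values of \<open>\<psi>\<close> on $[0,1]$ and those of the weights on $[0,\infty)$ enter the theorem, so the
  three functions may be extended by constants. Working with functions on the whole line makes them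
  Borel functions of a real variable and keeps the domains out of the integrals.
\<close>

locale hardy_cesaro =
  fixes \<psi> \<omega>1 \<omega>2 :: "real \<Rightarrow> real" and C :: real
  assumes psi_cont: "continuous_on UNIV \<psi>" and psi_nonneg: "0 \<le> \<psi> t"
    and w1_cont: "continuous_on UNIV \<omega>1" and w1_pos: "0 < \<omega>1 t"
    and w2_cont: "continuous_on UNIV \<omega>2" and w2_pos: "0 < \<omega>2 t"
    and C_nonneg: "0 \<le> C"
    and bound: "s \<ge> 0 \<Longrightarrow>
      (\<integral>\<^sup>+t\<in>{0..1}. ennreal (\<omega>2 (s / t) * (\<psi> t / t)) \<partial>lborel) \<le> ennreal (C * \<omega>1 s)"
begin

lemma measurable_weights [measurable]:
  "\<psi> \<in> borel_measurable borel" "\<omega>1 \<in> borel_measurable borel" "\<omega>2 \<in> borel_measurable borel"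
  using psi_cont w1_cont w2_cont by (auto intro: borel_measurable_continuous_onI)

text \<open>
  The continuous representative of the adjoint of \<open>U_op \<psi>\<close> applied to \<open>g\<close>.
\<close>

definition V :: "(real \<Rightarrow> complex) \<Rightarrow> real \<Rightarrow> complex" where
  "V g x = (LINT t:{0..1}|lborel. g (x / t) * of_real (\<psi> t / t))"

definition K :: "real \<Rightarrow> real \<Rightarrow> real" where
  "K s x = (if 0 < s \<and> s < x then \<psi> (s / x) / x else 0)"

lemma norm_kernel: "0 \<le> t \<Longrightarrow> norm (z * complex_of_real (\<psi> t / t)) = norm z * (\<psi> t / t)"
  using psi_nonneg[of t] by (simp add: norm_mult norm_divide)

lemma K_nonneg: "0 \<le> K s x"
  using psi_nonneg by (auto simp: K_def)

lemma measurable_K [measurable]: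
  assumes [measurable]: "f \<in> borel_measurable N" "g \<in> borel_measurable N"
  shows "(\<lambda>z. K (f z) (g z)) \<in> borel_measurable N"
  unfolding K_def by measurable

lemma psi_kernel: "s / x\<^sup>2 * (\<psi> (s / x) / (s / x)) = K s x" if "0 < s" "s < x"
  using that by (simp add: K_def field_simps power2_eq_square)

text \<open>
  The substitution \<open>t = s / x\<close>. The point \<open>x = s\<close>, which corresponds to \<open>t = 1\<close> and at which
  \<open>K s\<close> is 0, is a null set; at \<open>t = 0\<close> the integrand is 0 because \<open>\<psi> 0 / 0 = 0\<close>.
\<close>

lemma nn_integral_K:
  fixes F :: "real \<Rightarrow> ennreal"
  assumes s: "s > 0" and F [measurable]: "F \<in> borel_measurable borel"
  shows "(\<integral>\<^sup>+x. F x * ennreal (K s x) \<partial>lborel) = (\<integral>\<^sup>+t\<in>{0..1}. F (s / t) * ennreal (\<psi> t / t) \<partial>lborel)"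
proof -
  have "(\<integral>\<^sup>+t\<in>{0..1}. F (s / t) * ennreal (\<psi> t / t) \<partial>lborel) = (\<integral>\<^sup>+t\<in>{0<..1}. F (s / t) * ennreal (\<psi> t / t) \<partial>lborel)"
    by (intro nn_integral_cong) (auto split: split_indicator)
  also have "\<dots> = (\<integral>\<^sup>+x\<in>{s..}. ennreal (s / x\<^sup>2) * (F (s / (s / x)) * ennreal (\<psi> (s / x) / (s / x))) \<partial>lborel)"
    by (rule nn_integral_inversion[OF s]) measurable
  also have "\<dots> = (\<integral>\<^sup>+x. F x * ennreal (K s x) \<partial>lborel)"
  proof (rule nn_integral_cong_AE)
    show "AE x in lborel. ennreal (s / x\<^sup>2) * (F (s / (s / x)) * ennreal (\<psi> (s / x) / (s / x))) * indicator {s..} x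
        = F x * ennreal (K s x)"
      using AE_lborel_singleton[of s]
    proof eventually_elim
      fix x assume x: "x \<noteq> s"
      show "ennreal (s / x\<^sup>2) * (F (s / (s / x)) * ennreal (\<psi> (s / x) / (s / x))) * indicator {s..} x = F x * ennreal (K s x)"
      proof (cases "s < x")
        case True
        have "ennreal (s / x\<^sup>2) * ennreal (\<psi> (s / x) / (s / x)) = ennreal (K s x)"
          using s True psi_nonneg[of "s / x"] by (subst ennreal_mult[symmetric]) (simp_all only: psi_kernel, simp_all)
        then have "ennreal (s / x\<^sup>2) * (F x * ennreal (\<psi> (s / x) / (s / x))) = F x * ennreal (K s x)"
          by (simp only: mult.left_commute)
        then show ?thesis using s True by simp
      qed (use x in \<open>auto simp: K_def\<close>)
    qed
  qed
  finally show ?thesis ..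
qed

lemma integral_K:
  assumes s: "s > 0" and g [measurable]: "g \<in> borel_measurable borel"
  shows "(\<integral>x. g x * of_real (K s x) \<partial>lborel) = V g s"
proof -
  have "V g s = (LINT t:{0<..1}|lborel. g (s / t) * of_real (\<psi> t / t))"
    unfolding V_def set_lebesgue_integral_def
    by (intro Bochner_Integration.integral_cong) (auto split: split_indicator)
  also have "\<dots> = (LINT x:{s..}|lborel. of_real (s / x\<^sup>2) * (g (s / (s / x)) * of_real (\<psi> (s / x) / (s / x))))"
    by (rule integral_inversion[OF s]) measurable
  also have "\<dots> = (\<integral>x. g x * of_real (K s x) \<partial>lborel)"
    unfolding set_lebesgue_integral_def
  proof (rule integral_cong_AE)
    show "AE x in lborel. indicator {s..} x *\<^sub>R (of_real (s / x\<^sup>2) * (g (s / (s / x)) * of_real (\<psi> (s / x) / (s / x)))) =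
       g x * of_real (K s x)"
      using AE_lborel_singleton[of s]
    proof eventually_elim
      fix x assume x: "x \<noteq> s"
      show "indicator {s..} x *\<^sub>R (of_real (s / x\<^sup>2) * (g (s / (s / x)) * of_real (\<psi> (s / x) / (s / x)))) =
       g x * of_real (K s x)"
      proof (cases "s < x")
        case True
        have "complex_of_real (s / x\<^sup>2) * of_real (\<psi> (s / x) / (s / x)) = of_real (K s x)"
          using s True by (simp only: of_real_mult[symmetric] psi_kernel)
        then have "of_real (s / x\<^sup>2) * (g x * of_real (\<psi> (s / x) / (s / x))) = g x * of_real (K s x)"
          by (simp only: mult.left_commute)
        then show ?thesis using s True by simp
      qed (use x in \<open>auto simp: K_def\<close>)
    qed
  qed measurable
  finally show ?thesis ..
qed

section \<open>The adjoint on continuous functions\<close>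

text \<open>
  The hypothesis on the weights makes \<open>V\<close> bounded between the weighted spaces.
\<close>

lemma V_majorant:
  assumes x: "x \<ge> 0" and f: "\<And>y. y \<ge> 0 \<Longrightarrow> norm (f y) \<le> \<epsilon> * \<omega>2 y" and \<epsilon>: "\<epsilon> \<ge> 0"
  shows "(\<integral>\<^sup>+t. ennreal (norm (indicator {0..1} t *\<^sub>R (f (x / t) * complex_of_real (\<psi> t / t)))) \<partial>lborel)
     \<le> ennreal (\<epsilon> * C * \<omega>1 x)"
proof -
  have "(\<integral>\<^sup>+t. ennreal (norm (indicator {0..1} t *\<^sub>R (f (x / t) * complex_of_real (\<psi> t / t)))) \<partial>lborel)
      \<le> (\<integral>\<^sup>+t. ennreal \<epsilon> * (ennreal (\<omega>2 (x / t) * (\<psi> t / t)) * indicator {0..1} t) \<partial>lborel)"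
  proof (rule nn_integral_mono)
    fix t
    have "norm (f (x / t)) * (\<psi> t / t) \<le> \<epsilon> * \<omega>2 (x / t) * (\<psi> t / t)" if "0 \<le> t"
      using that x psi_nonneg[of t] by (intro mult_right_mono f) auto
    then show "ennreal (norm (indicator {0..1} t *\<^sub>R (f (x / t) * complex_of_real (\<psi> t / t))))
       \<le> ennreal \<epsilon> * (ennreal (\<omega>2 (x / t) * (\<psi> t / t)) * indicator {0..1} t)"
      using \<epsilon>
      by (cases "t \<in> {0..1}") (simp_all add: norm_kernel ennreal_mult'[symmetric] mult.assoc ennreal_leI del: of_real_divide)
  qed
  also have "\<dots> = ennreal \<epsilon> * (\<integral>\<^sup>+t\<in>{0..1}. ennreal (\<omega>2 (x / t) * (\<psi> t / t)) \<partial>lborel)"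
    by (rule nn_integral_cmult) measurable
  also have "\<dots> \<le> ennreal \<epsilon> * ennreal (C * \<omega>1 x)"
    by (intro mult_left_mono bound x) auto
  also have "\<dots> = ennreal (\<epsilon> * C * \<omega>1 x)"
    using \<epsilon> by (simp add: ennreal_mult' mult.assoc)
  finally show ?thesis .
qed

lemma V_integrable:
  assumes x: "x \<ge> 0" and f: "\<And>y. y \<ge> 0 \<Longrightarrow> norm (f y) \<le> \<epsilon> * \<omega>2 y" and \<epsilon>: "\<epsilon> \<ge> 0"
    and [measurable]: "f \<in> borel_measurable borel"
  shows "set_integrable lborel {0..1} (\<lambda>t. f (x / t) * complex_of_real (\<psi> t / t))"
  unfolding set_integrable_def
proof (rule integrableI_bounded)
  have "ennreal (\<epsilon> * C * \<omega>1 x) < \<infinity>" by simp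
  then show "(\<integral>\<^sup>+t. ennreal (norm (indicator {0..1} t *\<^sub>R (f (x / t) * complex_of_real (\<psi> t / t)))) \<partial>lborel) < \<infinity>"
    using V_majorant[OF x f \<epsilon>] by (rule order_le_less_trans[rotated])
qed measurable

lemma V_bound:
  assumes x: "x \<ge> 0" and f: "\<And>y. y \<ge> 0 \<Longrightarrow> norm (f y) \<le> \<epsilon> * \<omega>2 y" and \<epsilon>: "\<epsilon> \<ge> 0"
    and [measurable]: "f \<in> borel_measurable borel"
  shows "norm (V f x) \<le> \<epsilon> * C * \<omega>1 x"
proof -
  have "ennreal (norm (V f x)) \<le> ennreal (\<epsilon> * C * \<omega>1 x)"
    unfolding V_def set_lebesgue_integral_def
    using V_integrable[OF assms] unfolding set_integrable_def
    by (rule order_trans[OF integral_norm_bound_ennreal V_majorant[OF x f \<epsilon>]])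
  moreover have "0 \<le> \<epsilon> * C * \<omega>1 x" using \<epsilon> C_nonneg w1_pos[of x] by simp
  ultimately show ?thesis by (simp add: ennreal_le_iff)
qed

text \<open>
  This is the hypothesis at the point 0, where \<open>\<omega>2 (0 / t)\<close> is the constant \<open>\<omega>2 0\<close>.
\<close>

lemma psi_over_t_integrable: "set_integrable lborel {0..1} (\<lambda>t. \<psi> t / t)"
proof -
  \<comment> \<open>The argument of the function is \<open>0 / t = 0\<close> throughout.\<close>
  let ?f = "\<lambda>y. complex_of_real (indicator {0} y * \<omega>2 0)"
  have "norm (?f y) \<le> 1 * \<omega>2 y" for y
    using w2_pos by (auto split: split_indicator intro: less_imp_le)
  then have "set_integrable lborel {0..1} (\<lambda>t. ?f (0 / t) * complex_of_real (\<psi> t / t))"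
    by (intro V_integrable[of _ _ 1]) auto
  then have "set_integrable lborel {0..1} (\<lambda>t. complex_of_real (\<omega>2 0) * complex_of_real (\<psi> t / t))"
    by simp
  then have "set_integrable lborel {0..1} (\<lambda>t. complex_of_real (\<psi> t / t))"
    using w2_pos[of 0] set_integrable_mult_right_iff[of "complex_of_real (\<omega>2 0)" lborel "{0..1}" "\<lambda>t. complex_of_real (\<psi> t / t)"]
    by (simp del: of_real_divide)
  then have "integrable lborel (\<lambda>t. Re (indicator {0..1} t *\<^sub>R complex_of_real (\<psi> t / t)))"
    unfolding set_integrable_def by (rule integrable_Re)
  then show ?thesis unfolding set_integrable_def by simp
qed

text \<open>
  The origin of the coefficient of \<open>delta0\<close> in the theorem.
\<close>

lemma V_0: "V g 0 = g 0 * complex_of_real (LINT t:{0..1}|lborel. \<psi> t / t)"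
  unfolding V_def by (simp only: div_0 set_integral_mult_right set_integral_complex_of_real)

lemma C0w_small_tail:
  assumes g: "g \<in> C0w \<omega>2" and e: "e > 0"
  obtains R where "R \<ge> 0" "\<And>x. x \<ge> R \<Longrightarrow> norm (g x) \<le> e * \<omega>2 x"
proof -
  have "eventually (\<lambda>t. dist (g t / complex_of_real (\<omega>2 t)) 0 < e) at_top"
    using g e by (intro tendstoD) (auto simp: C0w_def)
  then obtain R where R: "\<And>x. x \<ge> R \<Longrightarrow> norm (g x / complex_of_real (\<omega>2 x)) < e"
    by (auto simp: eventually_at_top_linorder)
  show thesis
  proof (rule that[of "max 0 R"])
    fix x assume "x \<ge> max 0 R"
    then have "norm (g x) / \<omega>2 x < e" using R[of x] w2_pos[of x] by (simp add: norm_divide)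
    then show "norm (g x) \<le> e * \<omega>2 x" using w2_pos[of x] by (simp add: field_simps)
  qed simp
qed

lemma C0w_bounded:
  assumes g: "g \<in> C0w \<omega>2"
  obtains D where "D \<ge> 0" "\<And>x. norm (g x) \<le> D * \<omega>2 x"
proof -
  obtain R where R: "R \<ge> 0" "\<And>x. x \<ge> R \<Longrightarrow> norm (g x) \<le> 1 * \<omega>2 x"
    using C0w_small_tail[OF g, of 1] by auto
  have "continuous_on {0..R} (\<lambda>x. norm (g x) / \<omega>2 x)"
  proof (intro continuous_intros)
    have "continuous_on {0..} g" using g by (simp add: C0w_def)
    then show "continuous_on {0..R} g" by (rule continuous_on_subset) auto
    show "continuous_on {0..R} \<omega>2" by (rule continuous_on_subset[OF w2_cont]) auto
    show "\<forall>x\<in>{0..R}. \<omega>2 x \<noteq> 0" using w2_pos by (metis less_irrefl)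
  qed
  then have "bounded ((\<lambda>x. norm (g x) / \<omega>2 x) ` {0..R})"
    using compact_continuous_image compact_imp_bounded by blast
  then obtain B where "\<forall>y\<in>(\<lambda>x. norm (g x) / \<omega>2 x) ` {0..R}. \<bar>y\<bar> \<le> B"
    unfolding bounded_real ..
  then have B: "norm (g x) / \<omega>2 x \<le> B" if "x \<in> {0..R}" for x
    using that abs_le_D1 by blast
  show thesis
  proof (rule that[of "max 1 B"])
    fix x
    show "norm (g x) \<le> max 1 B * \<omega>2 x"
    proof (cases "x < 0")
      case True
      then show ?thesis using g w2_pos[of x] by (simp add: C0w_def less_imp_le)
    next
      case False
      show ?thesis
      proof (cases "x \<le> R")
        case True
        then have "norm (g x) \<le> B * \<omega>2 x" using B[of x] False w2_pos[of x] by (simp add: field_simps)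
        also have "\<dots> \<le> max 1 B * \<omega>2 x" using w2_pos[of x] by (intro mult_right_mono) auto
        finally show ?thesis .
      next
        case False
        then have "norm (g x) \<le> 1 * \<omega>2 x" by (intro R) auto
        also have "\<dots> \<le> max 1 B * \<omega>2 x" using w2_pos[of x] by (intro mult_right_mono) auto
        finally show ?thesis .
      qed
    qed
  qed simp
qed

text \<open>
  For a bounded function, \<open>\<psi> t / t\<close> gives an integrable majorant. Functions in $C_0(1/\omega_2)$
  can be unbounded, which is why the next lemma cuts them off.
\<close>

lemma V_continuous:
  assumes g: "continuous_on {0..} g" "\<And>x. norm (g x) \<le> B" and [measurable]: "g \<in> borel_measurable borel"
  shows "continuous_on {0..} (V g)"
proof (rule continuous_on_sequentiallyI)
  fix u :: "nat \<Rightarrow> real" and a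
  assume u: "\<forall>n. u n \<in> {0..}" "a \<in> {0..}" "u \<longlonglongrightarrow> a"
  show "(\<lambda>n. V g (u n)) \<longlonglongrightarrow> V g a"
    unfolding V_def set_lebesgue_integral_def
  proof (rule integral_dominated_convergence[where w="\<lambda>t. B * (indicator {0..1} t *\<^sub>R (\<psi> t / t))"])
    show "integrable lborel (\<lambda>t. B * (indicator {0..1} t *\<^sub>R (\<psi> t / t)))"
      using psi_over_t_integrable unfolding set_integrable_def by (rule integrable_mult_right)
    show "AE t in lborel. (\<lambda>n. indicator {0..1} t *\<^sub>R (g (u n / t) * complex_of_real (\<psi> t / t)))
        \<longlonglongrightarrow> indicator {0..1} t *\<^sub>R (g (a / t) * complex_of_real (\<psi> t / t))"
    proof (rule AE_I2)
      fix t
      show "(\<lambda>n. indicator {0..1} t *\<^sub>R (g (u n / t) * complex_of_real (\<psi> t / t)))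
        \<longlonglongrightarrow> indicator {0..1} t *\<^sub>R (g (a / t) * complex_of_real (\<psi> t / t))"
      proof (cases "0 < t")
        case True
        have "(\<lambda>n. g (u n / t)) \<longlonglongrightarrow> g (a / t)"
          using u True by (intro continuous_on_tendsto_compose[OF g(1)] tendsto_intros) auto
        then show ?thesis by (intro tendsto_intros)
      qed (cases "t = 0"; simp)
    qed
    show "AE t in lborel. norm (indicator {0..1} t *\<^sub>R (g (u n / t) * complex_of_real (\<psi> t / t)))
        \<le> B * (indicator {0..1} t *\<^sub>R (\<psi> t / t))" for n
    proof (rule AE_I2)
      fix t
      show "norm (indicator {0..1} t *\<^sub>R (g (u n / t) * complex_of_real (\<psi> t / t))) \<le> B * (indicator {0..1} t *\<^sub>R (\<psi> t / t))"
        using mult_right_mono[OF g(2)[of "u n / t"], of "\<psi> t / t"] psi_nonneg[of t]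
        by (cases "t \<in> {0..1}") (simp_all add: norm_kernel del: of_real_divide)
    qed
  qed measurable
qed

text \<open>
  Cut off \<open>g\<close> where it is already small compared to \<open>\<omega>2\<close>: the error remains small compared to
  \<open>\<omega>1\<close> under \<open>V\<close>, and \<open>V\<close> of a function vanishing beyond \<open>R\<close> vanishes beyond \<open>R\<close>, as \<open>x / t \<ge> x\<close>.
\<close>

lemma V_C0w_approx:
  assumes g: "g \<in> C0w \<omega>2" and e: "e > 0"
  obtains k R where "continuous_on {0..} k" "\<And>x. x \<ge> R \<Longrightarrow> k x = 0" "R \<ge> 0"
    "\<And>x. x \<ge> 0 \<Longrightarrow> norm (V g x - k x) \<le> e * C * \<omega>1 x"
proof -
  obtain R where R: "R \<ge> 0" "\<And>x. x \<ge> R \<Longrightarrow> norm (g x) \<le> e * \<omega>2 x"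
    using C0w_small_tail[OF g e] by auto
  have gm [measurable]: "g \<in> borel_measurable borel" by (rule C0w_measurable[OF g])
  have cm [measurable]: "cutoff R 1 \<in> borel_measurable borel"
    using C0w_measurable[OF cutoff_C0w] by simp
  have gc: "continuous_on {0..} g" using g by (simp add: C0w_def)
  have cc: "continuous_on {0..} (cutoff R 1)" using cutoff_C0w[of 1 R \<omega>2] by (simp add: C0w_def)
  define k where "k x = g x * cutoff R 1 x" for x
  have km [measurable]: "k \<in> borel_measurable borel" unfolding k_def by measurable
  have kc: "continuous_on {0..} k" unfolding k_def by (intro continuous_intros gc cc)
  have c1: "norm (cutoff R 1 x) \<le> 1" "norm (1 - cutoff R 1 x) \<le> 1" for x
  proof -
    show "norm (cutoff R 1 x) \<le> 1" by (auto simp: cutoff_def)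
    have "norm (1 - complex_of_real y) \<le> 1" if "0 \<le> y" "y \<le> 1" for y
      using that norm_of_real[of "1 - y", where 'a=complex] by simp
    then show "norm (1 - cutoff R 1 x) \<le> 1" by (auto simp: cutoff_def)
  qed
  have k0: "k x = 0" if "x < 0 \<or> x \<ge> R + 1" for x
    using that g R(1) by (auto simp: k_def cutoff_def)
  have "bounded (k ` {0..R+1})"
    by (intro compact_imp_bounded compact_continuous_image continuous_on_subset[OF kc]) auto
  then obtain B where "\<forall>x\<in>{0..R+1}. norm (k x) \<le> B" unfolding bounded_iff by auto
  then have B: "norm (k x) \<le> B" if "x \<in> {0..R+1}" for x using that by blast
  have "0 \<le> B" using B[of 0] R(1) norm_ge_zero[of "k 0"] by (simp del: norm_ge_zero)
  have B': "norm (k x) \<le> B" for x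
    using B[of x] k0[of x] \<open>0 \<le> B\<close> by (cases "x \<in> {0..R+1}") auto
  have Vk0: "V k x = 0" if x: "x \<ge> R + 1" for x
  proof -
    have "indicator {0..1} t *\<^sub>R (k (x / t) * complex_of_real (\<psi> t / t)) = 0" for t
    proof (cases "0 < t \<and> t \<le> 1")
      case True
      then have "x / t \<ge> x" using x R(1) by (simp add: le_divide_eq mult_left_le)
      then show ?thesis using k0[of "x / t"] x by simp
    next
      case False
      then show ?thesis by (cases "t = 0") (auto split: split_indicator)
    qed
    then show ?thesis
      unfolding V_def set_lebesgue_integral_def by (simp only: Bochner_Integration.integral_zero)
  qed
  have gk: "norm (g x - k x) \<le> e * \<omega>2 x" if "x \<ge> 0" for x
  proof (cases "x \<le> R")
    case True
    then have "cutoff R 1 x = 1" using that by (auto simp: cutoff_def)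
    then show ?thesis using e w2_pos[of x] by (simp add: k_def)
  next
    case False
    have "norm (g x - k x) = norm (g x) * norm (1 - cutoff R 1 x)"
      by (simp add: k_def norm_mult[symmetric] algebra_simps)
    also have "\<dots> \<le> norm (g x)" using c1 by (intro mult_left_le) auto
    also have "\<dots> \<le> e * \<omega>2 x" using R(2)[of x] False by simp
    finally show ?thesis .
  qed
  have diff: "norm (V g x - V k x) \<le> e * C * \<omega>1 x" if x: "x \<ge> 0" for x
  proof -
    obtain D where D: "D \<ge> 0" "\<And>x. norm (g x) \<le> D * \<omega>2 x" using C0w_bounded[OF g] by auto
    have Dk: "norm (k x) \<le> D * \<omega>2 x" for x
    proof -
      have "norm (k x) \<le> norm (g x)" unfolding k_def norm_mult using c1 by (intro mult_left_le) auto
      then show ?thesis using D(2)[of x] by simp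
    qed
    have "V g x - V k x = (LINT t:{0..1}|lborel. g (x / t) * complex_of_real (\<psi> t / t) - k (x / t) * complex_of_real (\<psi> t / t))"
      unfolding V_def by (subst set_integral_diff) (use V_integrable[OF x D(2) D(1) gm] V_integrable[OF x Dk D(1) km] in auto)
    also have "\<dots> = V (\<lambda>y. g y - k y) x"
      unfolding V_def by (simp add: algebra_simps)
    finally show ?thesis
      using V_bound[OF x, of "\<lambda>y. g y - k y" e] gk e by simp
  qed
  show thesis
    by (rule that[of "V k" "R + 1"]) (use diff Vk0 R(1) V_continuous[OF kc B' km] in auto)
qed

text \<open>
  By the approximation, \<open>V g / \<omega>1\<close> is a uniform limit of continuous functions that vanish for
  large arguments.
\<close>

lemma V_C0w:
  assumes g: "g \<in> C0w \<omega>2" shows "V g \<in> C0w \<omega>1"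
proof -
  have nz: "\<omega>1 x \<noteq> 0" for x using w1_pos[of x] by simp
  have approx: "\<exists>k R. continuous_on {0..} k \<and> (\<forall>x\<ge>R. k x = 0) \<and> R \<ge> 0 \<and>
      (\<forall>x\<ge>0. norm (V g x / of_real (\<omega>1 x) - k x / of_real (\<omega>1 x)) < e)" if e: "e > 0" for e
  proof -
    obtain k R where k: "continuous_on {0..} k" "\<And>x. x \<ge> R \<Longrightarrow> k x = 0" "R \<ge> 0"
        "\<And>x. x \<ge> 0 \<Longrightarrow> norm (V g x - k x) \<le> e / (C + 1) * C * \<omega>1 x"
      using V_C0w_approx[OF g, of "e / (C + 1)"] e C_nonneg by auto
    have "norm (V g x / of_real (\<omega>1 x) - k x / of_real (\<omega>1 x)) < e" if "x \<ge> 0" for x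
    proof -
      have "norm (V g x / of_real (\<omega>1 x) - k x / of_real (\<omega>1 x)) = norm (V g x - k x) / \<omega>1 x"
        using w1_pos[of x] by (simp add: diff_divide_distrib[symmetric] norm_divide)
      also have "\<dots> \<le> e / (C + 1) * C"
        using k(4)[OF that] w1_pos[of x] by (simp add: divide_le_eq)
      also have "\<dots> < e" using e C_nonneg by (simp add: field_simps)
      finally show ?thesis .
    qed
    then show ?thesis using k by blast
  qed
  have cont: "continuous_on {0..} (\<lambda>x. V g x / of_real (\<omega>1 x))"
  proof -
    have "\<forall>n. \<exists>k. continuous_on {0..} k \<and> (\<forall>x\<ge>0. norm (V g x / of_real (\<omega>1 x) - k x / of_real (\<omega>1 x)) < 1 / real (Suc n))"
    proof
      fix n
      show "\<exists>k. continuous_on {0..} k \<and> (\<forall>x\<ge>0. norm (V g x / of_real (\<omega>1 x) - k x / of_real (\<omega>1 x)) < 1 / real (Suc n))"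
      proof -
        have "0 < 1 / real (Suc n)" by simp
        from approx[OF this] show ?thesis by blast
      qed
    qed
    from choice[OF this]
    obtain k where k: "\<And>n. continuous_on {0..} (k n)"
      "\<And>n x. x \<ge> 0 \<Longrightarrow> norm (V g x / of_real (\<omega>1 x) - k n x / of_real (\<omega>1 x)) < 1 / real (Suc n)" by blast
    have "uniform_limit {0..} (\<lambda>n x. k n x / of_real (\<omega>1 x)) (\<lambda>x. V g x / of_real (\<omega>1 x)) sequentially"
    proof (rule uniform_limitI)
      fix e :: real assume "e > 0"
      then obtain N where N: "1 / real (Suc N) < e" using nat_approx_posE by blast
      have "\<forall>x\<in>{0..}. dist (k n x / of_real (\<omega>1 x)) (V g x / of_real (\<omega>1 x)) < e" if "n \<ge> N" for n
      proof
        fix x :: real assume "x \<in> {0..}"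
        then have "norm (V g x / of_real (\<omega>1 x) - k n x / of_real (\<omega>1 x)) < 1 / real (Suc n)" using k(2) by simp
        also have "\<dots> \<le> 1 / real (Suc N)" using that by (intro divide_left_mono) auto
        finally show "dist (k n x / of_real (\<omega>1 x)) (V g x / of_real (\<omega>1 x)) < e"
          using N by (simp add: dist_norm norm_minus_commute)
      qed
      then show "\<forall>\<^sub>F n in sequentially. \<forall>x\<in>{0..}. dist (k n x / of_real (\<omega>1 x)) (V g x / of_real (\<omega>1 x)) < e"
        by (rule eventually_sequentiallyI)
    qed
    moreover have "continuous_on {0..} (\<lambda>x. k n x / of_real (\<omega>1 x))" for n
      using nz by (intro continuous_intros k continuous_on_subset[OF w1_cont]) auto
    ultimately show ?thesis by (intro uniform_limit_theorem) auto
  qed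
  have "continuous_on {0..} (V g)"
  proof -
    have "continuous_on {0..} (\<lambda>x. V g x / of_real (\<omega>1 x) * of_real (\<omega>1 x))"
      by (intro continuous_intros cont continuous_on_subset[OF w1_cont]) auto
    then show ?thesis using nz by simp
  qed
  moreover have "((\<lambda>x. V g x / of_real (\<omega>1 x)) \<longlongrightarrow> 0) at_top"
  proof (rule tendstoI)
    fix e :: real assume "e > 0"
    from approx[OF this] obtain k R where "\<forall>x\<ge>R. k x = 0" "R \<ge> 0"
       "\<forall>x\<ge>0. norm (V g x / of_real (\<omega>1 x) - k x / of_real (\<omega>1 x)) < e" by blast
    then have "dist (V g x / of_real (\<omega>1 x)) 0 < e" if "x \<ge> R" for x
      using that by (metis diff_zero dist_norm div_0 order_trans)
    then show "\<forall>\<^sub>F x in at_top. dist (V g x / of_real (\<omega>1 x)) 0 < e"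
      by (auto simp: eventually_at_top_linorder)
  qed
  moreover have "V g x = 0" if "x < 0" for x
  proof -
    have "indicator {0..1} t *\<^sub>R (g (x / t) * complex_of_real (\<psi> t / t)) = 0" for t
    proof (cases "0 < t")
      case True
      then have "g (x / t) = 0" using g that by (simp add: C0w_def divide_neg_pos)
      then show ?thesis by simp
    qed (cases "t = 0"; simp)
    then show ?thesis
      unfolding V_def set_lebesgue_integral_def by (simp only: Bochner_Integration.integral_zero)
  qed
  ultimately show ?thesis by (simp add: C0w_def)
qed

text \<open>
  For \<open>p\<close> a positive part of \<open>\<mu>\<close> and \<open>h = 1\<close> this is a part of \<open>W_op \<psi> \<mu>\<close>; for \<open>p\<close> Lebesgue
  measure it is \<open>U_op \<psi> h\<close>.
\<close>

definition W :: "real measure \<Rightarrow> (real \<Rightarrow> complex) \<Rightarrow> real \<Rightarrow> complex" where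
  "W p h x = (\<integral>s. h s * of_real (K s x) \<partial>p)"

lemma W_nonpos:
  assumes "x \<le> 0" shows "W p h x = 0"
proof -
  have "K s x = 0" for s using assms by (simp add: K_def)
  then show ?thesis by (simp add: W_def)
qed

context
  fixes p :: "real measure" and h :: "real \<Rightarrow> complex"
  assumes sets_p: "sets p = sets half_line"
    and sigma_finite_p: "sigma_finite_measure p"
    and h [measurable]: "h \<in> borel_measurable p"
    and h_fin: "(\<integral>\<^sup>+s. ennreal (norm (h s) * \<omega>1 s) \<partial>p) < \<infinity>"
    and p0: "emeasure p {0} < \<infinity>"
begin

lemma id_measurable_p: "(\<lambda>s. s) \<in> borel_measurable p"
  by (intro borel_measurable_half_line[OF sets_p] continuous_intros)

lemma pair_sigma_finite_p: "pair_sigma_finite p lborel"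
  by (intro pair_sigma_finite.intro sigma_finite_p) (rule lborel.sigma_finite_measure_axioms)

text \<open>
  The estimate behind all uses of Fubini's theorem: by \<open>nn_integral_K\<close>, the inner integral is
  the left-hand side of the hypothesis.
\<close>

lemma nn_integral_h_K_w2:
  "(\<integral>\<^sup>+s. \<integral>\<^sup>+x. ennreal (norm (h s)) * (ennreal (\<omega>2 x) * ennreal (K s x)) \<partial>lborel \<partial>p) < \<infinity>"
proof -
  note id_measurable_p [measurable]
  have "(\<integral>\<^sup>+s. \<integral>\<^sup>+x. ennreal (norm (h s)) * (ennreal (\<omega>2 x) * ennreal (K s x)) \<partial>lborel \<partial>p)
     \<le> (\<integral>\<^sup>+s. ennreal C * ennreal (norm (h s) * \<omega>1 s) \<partial>p)"
  proof (rule nn_integral_mono)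
    fix s
    have "(\<integral>\<^sup>+x. ennreal (\<omega>2 x) * ennreal (K s x) \<partial>lborel) \<le> ennreal (C * \<omega>1 s)"
    proof (cases "s > 0")
      case True
      have "(\<integral>\<^sup>+x. ennreal (\<omega>2 x) * ennreal (K s x) \<partial>lborel)
        = (\<integral>\<^sup>+t\<in>{0..1}. ennreal (\<omega>2 (s / t)) * ennreal (\<psi> t / t) \<partial>lborel)"
        by (rule nn_integral_K[OF True]) measurable
      also have "\<dots> = (\<integral>\<^sup>+t\<in>{0..1}. ennreal (\<omega>2 (s / t) * (\<psi> t / t)) \<partial>lborel)"
        by (simp only: ennreal_mult'[OF less_imp_le[OF w2_pos]])
      also have "\<dots> \<le> ennreal (C * \<omega>1 s)" using True by (intro bound) simp
      finally show ?thesis .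
    qed (simp add: K_def)
    then have "ennreal (norm (h s)) * (\<integral>\<^sup>+x. ennreal (\<omega>2 x) * ennreal (K s x) \<partial>lborel)
        \<le> ennreal (norm (h s)) * ennreal (C * \<omega>1 s)"
      by (rule mult_left_mono) simp
    also have "\<dots> = ennreal C * ennreal (norm (h s) * \<omega>1 s)"
      using C_nonneg by (simp add: ennreal_mult'[symmetric] mult_ac)
    finally show "(\<integral>\<^sup>+x. ennreal (norm (h s)) * (ennreal (\<omega>2 x) * ennreal (K s x)) \<partial>lborel)
        \<le> ennreal C * ennreal (norm (h s) * \<omega>1 s)"
      by (subst nn_integral_cmult) auto
  qed
  also have "\<dots> = ennreal C * (\<integral>\<^sup>+s. ennreal (norm (h s) * \<omega>1 s) \<partial>p)"
    by (rule nn_integral_cmult) measurable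
  also have "\<dots> < \<infinity>" using h_fin by (simp add: ennreal_mult_less_top)
  finally show ?thesis .
qed

lemma measurable_W: "W p h \<in> borel_measurable borel"
proof -
  note id_measurable_p [measurable]
  interpret p: sigma_finite_measure p by (rule sigma_finite_p)
  have "(\<lambda>x. \<integral>s. h s * of_real (K s x) \<partial>p) \<in> borel_measurable lborel"
    by (rule p.borel_measurable_lebesgue_integral) measurable
  then show ?thesis unfolding W_def[abs_def] by simp
qed

lemma W_weighted_finite: "(\<integral>\<^sup>+x. ennreal (norm (W p h x) * \<omega>2 x) \<partial>lborel) < \<infinity>"
proof -
  note id_measurable_p [measurable]
  interpret pair_sigma_finite p lborel by (rule pair_sigma_finite_p)
  have "(\<integral>\<^sup>+x. ennreal (norm (W p h x) * \<omega>2 x) \<partial>lborel)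
      \<le> (\<integral>\<^sup>+x. \<integral>\<^sup>+s. ennreal (norm (h s)) * (ennreal (\<omega>2 x) * ennreal (K s x)) \<partial>p \<partial>lborel)"
  proof (rule nn_integral_mono)
    fix x
    have "ennreal (norm (W p h x)) \<le> (\<integral>\<^sup>+s. ennreal (norm (h s * of_real (K s x))) \<partial>p)"
      unfolding W_def
      by (cases "integrable p (\<lambda>s. h s * of_real (K s x))")
        (auto intro: integral_norm_bound_ennreal simp: not_integrable_integral_eq)
    then have "ennreal (norm (W p h x)) * ennreal (\<omega>2 x) \<le> (\<integral>\<^sup>+s. ennreal (norm (h s * of_real (K s x))) \<partial>p) * ennreal (\<omega>2 x)"
      by (rule mult_right_mono) simp
    also have "\<dots> = (\<integral>\<^sup>+s. ennreal (norm (h s * of_real (K s x))) * ennreal (\<omega>2 x) \<partial>p)"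
      by (rule nn_integral_multc[symmetric]) measurable
    also have "\<dots> = (\<integral>\<^sup>+s. ennreal (norm (h s)) * (ennreal (\<omega>2 x) * ennreal (K s x)) \<partial>p)"
      using K_nonneg by (intro nn_integral_cong) (simp add: norm_mult ennreal_mult mult_ac)
    finally show "ennreal (norm (W p h x) * \<omega>2 x) \<le> (\<integral>\<^sup>+s. ennreal (norm (h s)) * (ennreal (\<omega>2 x) * ennreal (K s x)) \<partial>p)"
      using w2_pos[of x] by (simp add: ennreal_mult)
  qed
  also have "\<dots> = (\<integral>\<^sup>+s. \<integral>\<^sup>+x. ennreal (norm (h s)) * (ennreal (\<omega>2 x) * ennreal (K s x)) \<partial>lborel \<partial>p)"
    by (rule Fubini') measurable
  also have "\<dots> < \<infinity>" by (rule nn_integral_h_K_w2)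
  finally show ?thesis .
qed

lemma integrable_W:
  assumes g: "\<And>x. norm (g x) \<le> D * \<omega>2 x" and [measurable]: "g \<in> borel_measurable borel" and D: "D \<ge> 0"
  shows "integrable lborel (\<lambda>x. W p h x * g x)"
proof (rule integrableI_bounded)
  have wm [measurable]: "W p h \<in> borel_measurable borel" by (rule measurable_W)
  have "(\<integral>\<^sup>+x. ennreal (norm (W p h x * g x)) \<partial>lborel) \<le> (\<integral>\<^sup>+x. ennreal D * ennreal (norm (W p h x) * \<omega>2 x) \<partial>lborel)"
  proof (rule nn_integral_mono)
    fix x
    have "norm (W p h x * g x) \<le> D * (norm (W p h x) * \<omega>2 x)"
      unfolding norm_mult using mult_left_mono[OF g[of x], of "norm (W p h x)"] by (simp add: mult_ac)
    then show "ennreal (norm (W p h x * g x)) \<le> ennreal D * ennreal (norm (W p h x) * \<omega>2 x)"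
      using D by (simp add: ennreal_mult'[symmetric] ennreal_leI)
  qed
  also have "\<dots> = ennreal D * (\<integral>\<^sup>+x. ennreal (norm (W p h x) * \<omega>2 x) \<partial>lborel)"
    by (rule nn_integral_cmult) measurable
  also have "\<dots> < \<infinity>" using W_weighted_finite by (simp add: ennreal_mult_less_top)
  finally show "(\<integral>\<^sup>+x. ennreal (norm (W p h x * g x)) \<partial>lborel) < \<infinity>" .
  show "(\<lambda>x. W p h x * g x) \<in> borel_measurable lborel" by measurable
qed

text \<open>
  The kernel vanishes for \<open>s = 0\<close>, so Fubini's theorem accounts for $(0,\infty)$ only, and the
  origin contributes the last term.
\<close>

lemma integral_V:
  assumes g: "\<And>x. norm (g x) \<le> D * \<omega>2 x" and gm [measurable]: "g \<in> borel_measurable borel" and D: "D \<ge> 0"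
  shows "(\<integral>s. h s * V g s \<partial>p) = (\<integral>x. W p h x * g x \<partial>lborel) + h 0 * V g 0 * of_real (measure p {0})"
proof -
  note id_measurable_p [measurable]
  interpret pair_sigma_finite p lborel by (rule pair_sigma_finite_p)
  let ?F = "\<lambda>s x. h s * (g x * of_real (K s x))"
  have int: "integrable (p \<Otimes>\<^sub>M lborel) (case_prod ?F)"
  proof (rule integrableI_bounded)
    have "(\<integral>\<^sup>+z. ennreal (norm (case_prod ?F z)) \<partial>(p \<Otimes>\<^sub>M lborel)) = (\<integral>\<^sup>+s. \<integral>\<^sup>+x. ennreal (norm (?F s x)) \<partial>lborel \<partial>p)"
      by (subst lborel.nn_integral_fst[symmetric]) auto
    also have "\<dots> \<le> (\<integral>\<^sup>+s. ennreal D * (\<integral>\<^sup>+x. ennreal (norm (h s)) * (ennreal (\<omega>2 x) * ennreal (K s x)) \<partial>lborel) \<partial>p)"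
    proof (rule nn_integral_mono)
      fix s
      have "(\<integral>\<^sup>+x. ennreal (norm (?F s x)) \<partial>lborel) \<le> (\<integral>\<^sup>+x. ennreal D * (ennreal (norm (h s)) * (ennreal (\<omega>2 x) * ennreal (K s x))) \<partial>lborel)"
      proof (rule nn_integral_mono)
        fix x
        have "norm (?F s x) = norm (g x) * (norm (h s) * K s x)"
          using K_nonneg by (simp add: norm_mult)
        also have "\<dots> \<le> D * \<omega>2 x * (norm (h s) * K s x)"
          using K_nonneg by (intro mult_right_mono g) auto
        also have "\<dots> = D * (norm (h s) * (\<omega>2 x * K s x))" by (simp add: mult_ac)
        finally have "ennreal (norm (?F s x)) \<le> ennreal (D * (norm (h s) * (\<omega>2 x * K s x)))" by (rule ennreal_leI)
        then show "ennreal (norm (?F s x)) \<le> ennreal D * (ennreal (norm (h s)) * (ennreal (\<omega>2 x) * ennreal (K s x)))"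
          using D w2_pos[of x] by (simp add: ennreal_mult' less_imp_le)
      qed
      then show "(\<integral>\<^sup>+x. ennreal (norm (?F s x)) \<partial>lborel) \<le> ennreal D * (\<integral>\<^sup>+x. ennreal (norm (h s)) * (ennreal (\<omega>2 x) * ennreal (K s x)) \<partial>lborel)"
        by (subst (asm) nn_integral_cmult) auto
    qed
    also have "\<dots> = ennreal D * (\<integral>\<^sup>+s. \<integral>\<^sup>+x. ennreal (norm (h s)) * (ennreal (\<omega>2 x) * ennreal (K s x)) \<partial>lborel \<partial>p)"
      by (rule nn_integral_cmult) measurable
    also have "\<dots> < \<infinity>" using nn_integral_h_K_w2 by (simp add: ennreal_mult_less_top)
    finally show "(\<integral>\<^sup>+z. ennreal (norm (case_prod ?F z)) \<partial>(p \<Otimes>\<^sub>M lborel)) < \<infinity>" .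
  qed measurable
  have "(\<integral>x. W p h x * g x \<partial>lborel) = (\<integral>x. \<integral>s. ?F s x \<partial>p \<partial>lborel)"
    unfolding W_def
  proof (intro Bochner_Integration.integral_cong refl)
    fix x
    have "(\<integral>s. h s * of_real (K s x) \<partial>p) * g x = (\<integral>s. h s * of_real (K s x) * g x \<partial>p)"
      by (rule integral_mult_left_zero[symmetric])
    then show "(\<integral>s. h s * of_real (K s x) \<partial>p) * g x = (\<integral>s. ?F s x \<partial>p)"
      by (simp add: mult_ac)
  qed
  also have "\<dots> = (\<integral>s. \<integral>x. ?F s x \<partial>lborel \<partial>p)"
    by (rule Fubini_integral[OF int])
  finally have W: "(\<integral>x. W p h x * g x \<partial>lborel) = (\<integral>s. \<integral>x. ?F s x \<partial>lborel \<partial>p)" .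
  have int1: "integrable p (\<lambda>s. \<integral>x. ?F s x \<partial>lborel)"
    using integrable_fst[OF int] by simp
  have zero_set: "{0} \<in> sets p" by (simp add: sets_p sets_half_line)
  have int2: "integrable p (\<lambda>s. indicator {0} s *\<^sub>R (h 0 * V g 0))"
    using zero_set p0 by (intro integrable_scaleR_left integrable_real_indicator) auto
  have "(\<integral>s. h s * V g s \<partial>p) = (\<integral>s. (\<integral>x. ?F s x \<partial>lborel) + indicator {0} s *\<^sub>R (h 0 * V g 0) \<partial>p)"
  proof (rule Bochner_Integration.integral_cong)
    fix s assume "s \<in> space p"
    then have "s \<ge> 0" by (simp add: space_eq_half_line[OF sets_p])
    show "h s * V g s = (\<integral>x. ?F s x \<partial>lborel) + indicator {0} s *\<^sub>R (h 0 * V g 0)"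
    proof (cases "s = 0")
      case True
      then show ?thesis by (simp add: K_def)
    next
      case False
      then have "s > 0" using \<open>s \<ge> 0\<close> by simp
      have "(\<integral>x. ?F s x \<partial>lborel) = h s * V g s"
        unfolding integral_K[OF \<open>s > 0\<close> gm, symmetric] by (rule integral_mult_right_zero)
      then show ?thesis using False by (simp del: integral_mult_right_zero)
    qed
  qed simp
  also have "\<dots> = (\<integral>s. \<integral>x. ?F s x \<partial>lborel \<partial>p) + (\<integral>s. indicator {0} s *\<^sub>R (h 0 * V g 0) \<partial>p)"
    by (rule Bochner_Integration.integral_add[OF int1 int2])
  also have "(\<integral>s. indicator {0} s *\<^sub>R (h 0 * V g 0) \<partial>p) = h 0 * V g 0 * of_real (measure p {0})"
    using zero_set p0
    by (subst integral_scaleR_left) (auto simp: scaleR_conv_of_real space_eq_half_line[OF sets_p] mult_ac intro!: integrable_real_indicator)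
  finally show ?thesis using W by simp
qed

end

section \<open>Identification of the adjoint\<close>

text \<open>
  The linear substitution \<open>s = x t\<close>.
\<close>

lemma W_lebesgue:
  assumes x: "x > 0" and f: "set_borel_measurable lborel {0..} f"
  shows "W (restrict_space lborel {0..}) f x = U_op \<psi> f x"
proof -
  let ?f = "\<lambda>s. indicator {0..} s *\<^sub>R f s"
  have fm [measurable]: "?f \<in> borel_measurable borel"
    using f by (simp add: set_borel_measurable_def)
  have "W (restrict_space lborel {0..}) f x = (\<integral>s. ?f s * of_real (K s x) \<partial>lborel)"
    unfolding W_def by (subst integral_restrict_space) (auto intro!: Bochner_Integration.integral_cong)
  also have "\<dots> = \<bar>x\<bar> *\<^sub>R (\<integral>t. ?f (0 + x * t) * of_real (K (0 + x * t) x) \<partial>lborel)"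
    using x by (intro lborel_integral_real_affine) auto
  also have "\<dots> = (\<integral>t. x *\<^sub>R (?f (x * t) * of_real (K (x * t) x)) \<partial>lborel)"
    using x by (simp only: integral_scaleR_right abs_of_pos add_0_left)
  also have "\<dots> = (\<integral>t. indicator {0<..<1} t *\<^sub>R (?f (t * x) * of_real (\<psi> t)) \<partial>lborel)"
    using x by (intro Bochner_Integration.integral_cong)
      (auto simp: K_def zero_less_mult_iff scaleR_conv_of_real mult_ac split: split_indicator)
  also have "\<dots> = (\<integral>t. indicator {0..1} t *\<^sub>R (?f (t * x) * of_real (\<psi> t)) \<partial>lborel)"
  proof (rule integral_cong_AE)
    show "AE t in lborel. indicator {0<..<1} t *\<^sub>R (?f (t * x) * of_real (\<psi> t)) = indicator {0..1} t *\<^sub>R (?f (t * x) * of_real (\<psi> t))"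
      using AE_lborel_singleton[of 0] AE_lborel_singleton[of 1] by eventually_elim (auto split: split_indicator)
  qed measurable
  also have "\<dots> = U_op \<psi> f x"
    unfolding U_op_def set_lebesgue_integral_def using x
    by (intro Bochner_Integration.integral_cong) (auto split: split_indicator)
  finally show ?thesis .
qed

lemma pairing_V:
  assumes f: "f \<in> L1w \<omega>1" and g: "g \<in> C0w \<omega>2"
  shows "pairing f (V g) = pairing (U_op \<psi> f) g"
proof -
  let ?p = "restrict_space lborel {0..} :: real measure"
  have fm: "set_borel_measurable lborel {0..} f" using f by (simp add: L1w_def)
  have fp: "f \<in> borel_measurable ?p"
    using fm by (simp add: borel_measurable_restrict_space_iff set_borel_measurable_def)
  have sp: "sets ?p = sets half_line" by (simp cong: sets_restrict_space_cong)
  have sf: "sigma_finite_measure ?p"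
    by (rule sigma_finite_measure_restrict_space) (auto intro: lborel.sigma_finite_measure_axioms)
  have fin: "(\<integral>\<^sup>+s. ennreal (norm (f s) * \<omega>1 s) \<partial>?p) < \<infinity>"
    using f by (subst nn_integral_restrict_space) (auto simp: L1w_def)
  have p0: "emeasure ?p {0} = 0" by (subst emeasure_restrict_space) auto
  have p0': "emeasure ?p {0} < \<infinity>" by (simp add: p0)
  obtain D where D: "D \<ge> 0" "\<And>x. norm (g x) \<le> D * \<omega>2 x" using C0w_bounded[OF g] by auto
  have gm: "g \<in> borel_measurable borel" by (rule C0w_measurable[OF g])
  have "pairing f (V g) = (\<integral>s. f s * V g s \<partial>?p)"
    unfolding pairing_def set_lebesgue_integral_def by (subst integral_restrict_space) auto
  also have "\<dots> = (\<integral>x. W ?p f x * g x \<partial>lborel)"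
    using integral_V[OF sp sf fp fin p0' D(2) gm D(1)] by (simp add: measure_def p0)
  also have "\<dots> = pairing (U_op \<psi> f) g"
    unfolding pairing_def set_lebesgue_integral_def
  proof (rule integral_cong_AE)
    have wm [measurable]: "W ?p f \<in> borel_measurable borel" by (rule measurable_W[OF sp sf fp fin p0'])
    have gm' [measurable]: "g \<in> borel_measurable borel" by (rule gm)
    show "(\<lambda>x. W ?p f x * g x) \<in> borel_measurable lborel" by measurable
    have U: "indicator {0..} x *\<^sub>R (U_op \<psi> f x * g x) =
        (if x > 0 then W ?p f x * g x else if x = 0 then U_op \<psi> f 0 * g 0 else 0)" for x
      using W_lebesgue[OF _ fm, of x] by auto
    show "(\<lambda>x. indicator {0..} x *\<^sub>R (U_op \<psi> f x * g x)) \<in> borel_measurable lborel"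
      unfolding U by measurable
    show "AE x in lborel. W ?p f x * g x = indicator {0..} x *\<^sub>R (U_op \<psi> f x * g x)"
      using AE_lborel_singleton[of 0] by eventually_elim (simp add: U W_nonpos)
  qed
  finally show ?thesis .
qed

end

text \<open>
  Pairing with the conjugate of the difference \<open>k1 - k2\<close>, restricted to an interval, gives the
  integral of the squared modulus of the difference.
\<close>

lemma C0w_eqI:
  assumes k: "k1 \<in> C0w \<omega>" "k2 \<in> C0w \<omega>" and \<omega>: "continuous_on {0..} \<omega>"
    and eq: "\<And>f. f \<in> L1w \<omega> \<Longrightarrow> pairing f k1 = pairing f k2"
  shows "k1 = k2"
proof
  fix x
  show "k1 x = k2 x"
  proof (cases "x < 0")
    case True
    then show ?thesis using k by (simp add: C0w_def)
  next
    case False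
    define b where "b = x + 1"
    have b: "0 < b" "x \<in> {0..b}" using False by (auto simp: b_def)
    define d where "d t = k1 t - k2 t" for t
    have kc: "continuous_on {0..b} k1" "continuous_on {0..b} k2" "continuous_on {0..b} \<omega>"
      using k \<omega> by (auto simp: C0w_def elim: continuous_on_subset)
    have dc: "continuous_on {0..b} d" unfolding d_def by (intro continuous_intros kc)
    have dm [measurable]: "d \<in> borel_measurable borel"
      unfolding d_def using C0w_measurable[OF k(1)] C0w_measurable[OF k(2)] by measurable
    define f where "f t = indicator {0..b} t *\<^sub>R cnj (d t)" for t
    have fm [measurable]: "f \<in> borel_measurable borel"
      unfolding f_def by (intro borel_measurable_scaleR borel_measurable_indicator
          measurable_compose[OF dm] borel_measurable_continuous_onI continuous_intros) auto
    have f: "f \<in> L1w \<omega>"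
    proof -
      have "set_integrable lborel {0..b} (\<lambda>t. norm (d t) * \<omega> t)"
        by (intro borel_integrable_atLeastAtMost' continuous_intros dc kc)
      then have "(\<integral>\<^sup>+t. ennreal (norm (indicator {0..b} t *\<^sub>R (norm (d t) * \<omega> t))) \<partial>lborel) < \<infinity>"
        unfolding set_integrable_def by (simp add: integrable_iff_bounded)
      moreover have "(\<integral>\<^sup>+t\<in>{0..}. ennreal (norm (f t) * \<omega> t) \<partial>lborel) \<le> (\<integral>\<^sup>+t. ennreal (norm (indicator {0..b} t *\<^sub>R (norm (d t) * \<omega> t))) \<partial>lborel)"
        unfolding f_def by (intro nn_integral_mono) (auto split: split_indicator simp: abs_le_iff intro!: ennreal_leI)
      ultimately show ?thesis unfolding L1w_def set_borel_measurable_def by (auto simp: order_le_less_trans)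
    qed
    have pair: "pairing f k = (LINT t:{0..b}|lborel. cnj (d t) * k t)" for k
      unfolding pairing_def set_lebesgue_integral_def f_def
      by (intro Bochner_Integration.integral_cong) (auto split: split_indicator)
    have "(LINT t:{0..b}|lborel. complex_of_real ((norm (d t))\<^sup>2)) = (LINT t:{0..b}|lborel. cnj (d t) * k1 t - cnj (d t) * k2 t)"
      by (intro arg_cong2[where f="set_lebesgue_integral lborel"] refl ext,
          simp only: complex_norm_square, simp add: d_def algebra_simps)
    also have "\<dots> = pairing f k1 - pairing f k2"
      unfolding pair by (intro set_integral_diff borel_integrable_atLeastAtMost' continuous_intros dc kc)
    also have "\<dots> = 0" using eq[OF f] by simp
    finally have "(LINT t:{0..b}|lborel. (norm (d t))\<^sup>2) = 0"
      unfolding set_integral_complex_of_real by simp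
    moreover have "set_integrable lborel {0..b} (\<lambda>t. (norm (d t))\<^sup>2)"
      by (intro borel_integrable_atLeastAtMost' continuous_intros dc)
    ultimately have "((\<lambda>t. (norm (d t))\<^sup>2) has_integral 0) {0..b}"
      using has_integral_set_lebesgue[of "{0..b}" "\<lambda>t. (norm (d t))\<^sup>2"]
      using set_borel_integral_eq_integral(1,2)[of "{0..b}" "\<lambda>t. (norm (d t))\<^sup>2"] by (simp add: has_integral_iff)
    moreover have "continuous_on {0..b} (\<lambda>t. (norm (d t))\<^sup>2)" by (intro continuous_intros dc)
    ultimately have "(norm (d x))\<^sup>2 = 0"
      using has_integral_0_cbox_imp_0[of 0 b "\<lambda>t. (norm (d t))\<^sup>2" x] b by (simp add: box_real)
    then show ?thesis by (simp add: d_def)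
  qed
qed

context hardy_cesaro begin

lemma V_op_eq:
  assumes g: "g \<in> C0w \<omega>2" shows "V_op \<psi> \<omega>1 \<omega>2 g = V g"
  unfolding V_op_def
proof (rule the_equality)
  show "V g \<in> C0w \<omega>1 \<and> (\<forall>f\<in>L1w \<omega>1. pairing f (V g) = pairing (U_op \<psi> f) g)"
    using V_C0w[OF g] pairing_V[OF _ g] by blast
  fix k assume "k \<in> C0w \<omega>1 \<and> (\<forall>f\<in>L1w \<omega>1. pairing f k = pairing (U_op \<psi> f) g)"
  then show "k = V g"
    using V_C0w[OF g] pairing_V[OF _ g] by (intro C0w_eqI[of k \<omega>1 "V g"] continuous_on_subset[OF w1_cont]) auto
qed

section \<open>The extension\<close>

text \<open>
  The conditions on the measure and the density in \<open>integral_V\<close>, for a positive part of \<open>\<mu>\<close> and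
  the density 1.
\<close>

lemma jordan_part_facts:
  assumes mu: "\<mu> \<in> Mw \<omega>1" and c: "c \<in> units4"
  shows "sigma_finite_measure (jordan_part c \<mu>)"
    and "(\<lambda>_. 1 :: complex) \<in> borel_measurable (jordan_part c \<mu>)"
    and "(\<integral>\<^sup>+s. ennreal (norm (1::complex) * \<omega>1 s) \<partial>jordan_part c \<mu>) < \<infinity>"
    and "A \<in> cpt_borel \<Longrightarrow> emeasure (jordan_part c \<mu>) A < \<infinity>"
proof -
  have w: "continuous_on {0..} \<omega>1" "\<forall>t\<ge>0. 0 < \<omega>1 t"
    using w1_pos by (auto intro: continuous_on_subset[OF w1_cont])
  show fin: "emeasure (jordan_part c \<mu>) A < \<infinity>" if "A \<in> cpt_borel" for A
    using weight_integrable_finite[OF _ w Mw_jordan_part[OF mu c]] that by simp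
  then show "sigma_finite_measure (jordan_part c \<mu>)"
    by (intro sigma_finite_half_line) auto
  show "(\<integral>\<^sup>+s. ennreal (norm (1::complex) * \<omega>1 s) \<partial>jordan_part c \<mu>) < \<infinity>"
    using Mw_jordan_part[OF mu c] by simp
qed simp

lemma W_op_eq: "W_op \<psi> \<mu> x = (\<Sum>c\<in>units4. c * W (jordan_part c \<mu>) (\<lambda>_. 1) x)"
proof -
  have "W (jordan_part c \<mu>) (\<lambda>_. 1) x = of_real (1 / x) * (\<integral>s. indicator {0<..<x} s * of_real (\<psi> (s / x)) \<partial>jordan_part c \<mu>)" for c
    unfolding W_def integral_mult_right_zero[symmetric]
    by (intro Bochner_Integration.integral_cong) (auto simp: K_def split: split_indicator)
  then show ?thesis
    unfolding W_op_def cm_integral_eq by (simp add: sum_distrib_left mult_ac)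
qed

lemma W_op_measurable:
  assumes mu: "\<mu> \<in> Mw \<omega>1" shows "W_op \<psi> \<mu> \<in> borel_measurable borel"
proof -
  have "(\<lambda>x. \<Sum>c\<in>units4. c * W (jordan_part c \<mu>) (\<lambda>_. 1) x) \<in> borel_measurable borel"
    using jordan_part_facts[OF mu]
    by (intro borel_measurable_sum borel_measurable_times borel_measurable_const measurable_W) auto
  then show ?thesis by (simp add: W_op_eq[abs_def])
qed

lemma W_op_weighted_finite:
  assumes mu: "\<mu> \<in> Mw \<omega>1"
  shows "(\<integral>\<^sup>+x. ennreal (norm (W_op \<psi> \<mu> x) * \<omega>2 x) \<partial>lborel) < \<infinity>"
proof -
  let ?W = "\<lambda>c. W (jordan_part c \<mu>) (\<lambda>_. 1)"
  have [measurable]: "?W c \<in> borel_measurable borel" if "c \<in> units4" for c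
    using jordan_part_facts[OF mu that] by (intro measurable_W) auto
  have "(\<integral>\<^sup>+x. ennreal (norm (W_op \<psi> \<mu> x) * \<omega>2 x) \<partial>lborel) \<le> (\<integral>\<^sup>+x. (\<Sum>c\<in>units4. ennreal (norm (?W c x) * \<omega>2 x)) \<partial>lborel)"
  proof (rule nn_integral_mono)
    fix x
    have "norm (W_op \<psi> \<mu> x) \<le> (\<Sum>c\<in>units4. norm (c * ?W c x))"
      unfolding W_op_eq by (rule norm_sum)
    also have "\<dots> = (\<Sum>c\<in>units4. norm (?W c x))"
      by (intro sum.cong) (auto simp: norm_mult norm_units4)
    finally have "norm (W_op \<psi> \<mu> x) * \<omega>2 x \<le> (\<Sum>c\<in>units4. norm (?W c x) * \<omega>2 x)"
      using w2_pos[of x] by (simp add: sum_distrib_right[symmetric] mult_right_mono)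
    then show "ennreal (norm (W_op \<psi> \<mu> x) * \<omega>2 x) \<le> (\<Sum>c\<in>units4. ennreal (norm (?W c x) * \<omega>2 x))"
      using w2_pos[of x] by (subst sum_ennreal) (auto intro!: ennreal_leI)
  qed
  also have "\<dots> = (\<Sum>c\<in>units4. \<integral>\<^sup>+x. ennreal (norm (?W c x) * \<omega>2 x) \<partial>lborel)"
    by (rule nn_integral_sum) measurable
  also have "\<dots> < \<infinity>"
  proof -
    have "(\<integral>\<^sup>+x. ennreal (norm (?W c x) * \<omega>2 x) \<partial>lborel) < \<infinity>" if "c \<in> units4" for c
      using jordan_part_facts[OF mu that] by (intro W_weighted_finite) auto
    then show ?thesis unfolding sum_units4 by (simp add: units4_def)
  qed
  finally show ?thesis .
qed

lemma W_op_L1w: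
  assumes mu: "\<mu> \<in> Mw \<omega>1" shows "W_op \<psi> \<mu> \<in> L1w \<omega>2"
proof -
  have "(\<integral>\<^sup>+x\<in>{0..}. ennreal (norm (W_op \<psi> \<mu> x) * \<omega>2 x) \<partial>lborel) \<le> (\<integral>\<^sup>+x. ennreal (norm (W_op \<psi> \<mu> x) * \<omega>2 x) \<partial>lborel)"
    by (intro nn_integral_mono) (auto split: split_indicator)
  then show ?thesis
    using W_op_weighted_finite[OF mu] W_op_measurable[OF mu]
    unfolding L1w_def set_borel_measurable_def by (auto simp: order_le_less_trans)
qed

definition psi_mass :: complex where
  "psi_mass = complex_of_real (LINT t:{0..1}|lborel. \<psi> t / t)"

lemma cm_integral_V:
  assumes mu: "\<mu> \<in> Mw \<omega>1" and g: "g \<in> C0w \<omega>2"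
  shows "cm_integral \<mu> (V g) = (\<integral>x. W_op \<psi> \<mu> x * g x \<partial>lborel) + psi_mass * \<mu> {0} * g 0"
    and "integrable lborel (\<lambda>x. W_op \<psi> \<mu> x * g x)"
proof -
  let ?W = "\<lambda>c. W (jordan_part c \<mu>) (\<lambda>_. 1)"
  obtain D where D: "D \<ge> 0" "\<And>x. norm (g x) \<le> D * \<omega>2 x" using C0w_bounded[OF g] by auto
  have gm: "g \<in> borel_measurable borel" by (rule C0w_measurable[OF g])
  note facts = jordan_part_facts[OF mu]
  have p0: "emeasure (jordan_part c \<mu>) {0} < \<infinity>" if "c \<in> units4" for c using facts(4)[OF that] by simp
  have int: "integrable lborel (\<lambda>x. c * (?W c x * g x))" if c: "c \<in> units4" for c
    by (intro integrable_mult_right integrable_W[OF _ facts(1)[OF c] facts(2)[OF c] facts(3)[OF c] p0[OF c] D(2) gm D(1)]) simp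
  have W: "W_op \<psi> \<mu> x * g x = (\<Sum>c\<in>units4. c * (?W c x * g x))" for x
    unfolding W_op_eq by (simp add: sum_distrib_right mult.assoc)
  show "integrable lborel (\<lambda>x. W_op \<psi> \<mu> x * g x)"
    unfolding W using int by (rule Bochner_Integration.integrable_sum)
  have part: "integral\<^sup>L (jordan_part c \<mu>) (V g) = (\<integral>x. ?W c x * g x \<partial>lborel) + V g 0 * of_real (measure (jordan_part c \<mu>) {0})"
    if c: "c \<in> units4" for c
    using integral_V[OF _ facts(1)[OF c] facts(2)[OF c] facts(3)[OF c] p0[OF c] D(2) gm D(1)] by simp
  have "cm_integral \<mu> (V g) = (\<Sum>c\<in>units4. c * ((\<integral>x. ?W c x * g x \<partial>lborel) + V g 0 * of_real (measure (jordan_part c \<mu>) {0})))"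
    unfolding cm_integral_eq using part by (intro sum.cong) auto
  also have "\<dots> = (\<Sum>c\<in>units4. \<integral>x. c * (?W c x * g x) \<partial>lborel) + V g 0 * (\<Sum>c\<in>units4. c * of_real (measure (jordan_part c \<mu>) {0}))"
    by (simp add: distrib_left sum.distrib sum_distrib_left mult_ac)
  also have "(\<Sum>c\<in>units4. \<integral>x. c * (?W c x * g x) \<partial>lborel) = (\<integral>x. W_op \<psi> \<mu> x * g x \<partial>lborel)"
    unfolding W using int by (rule Bochner_Integration.integral_sum[symmetric])
  also have "(\<Sum>c\<in>units4. c * of_real (measure (jordan_part c \<mu>) {0})) = \<mu> {0}"
    using mu p0 by (intro sum_jordan_part) (auto simp: Mw_def)
  finally show "cm_integral \<mu> (V g) = (\<integral>x. W_op \<psi> \<mu> x * g x \<partial>lborel) + psi_mass * \<mu> {0} * g 0"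
    by (simp add: V_0 psi_mass_def mult_ac)
qed

text \<open>
  The density with respect to \<open>lborel_delta\<close> of the measure in the theorem. Its value at the
  origin is the coefficient of \<open>delta0\<close>; there \<open>W_op \<psi> \<mu>\<close> only has a default value.
\<close>

definition Ubar_density :: "(real set \<Rightarrow> complex) \<Rightarrow> real \<Rightarrow> complex" where
  "Ubar_density \<mu> t = (if t = 0 then psi_mass * \<mu> {0} else W_op \<psi> \<mu> t)"

lemma Ubar_density_0: "Ubar_density \<mu> 0 = psi_mass * \<mu> {0}"
  by (simp add: Ubar_density_def)

lemma Ubar_density_measurable:
  assumes mu: "\<mu> \<in> Mw \<omega>1" shows "Ubar_density \<mu> \<in> borel_measurable borel"
proof -
  have [measurable]: "W_op \<psi> \<mu> \<in> borel_measurable borel" by (rule W_op_measurable[OF mu])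
  show ?thesis unfolding Ubar_density_def[abs_def] by measurable
qed

lemma measurable_lborel_deltaI:
  "f \<in> borel_measurable borel \<Longrightarrow> f \<in> borel_measurable lborel_delta" for f :: "real \<Rightarrow> 'b::topological_space"
  by (subst measurable_cong_sets[OF sets_lborel_delta refl]) (rule measurable_restrict_space1)

lemma Ubar_density_weighted_finite:
  assumes mu: "\<mu> \<in> Mw \<omega>1"
  shows "(\<integral>\<^sup>+t. ennreal (norm (Ubar_density \<mu> t) * \<omega>2 t) \<partial>lborel_delta) < \<infinity>"
proof -
  have [measurable]: "Ubar_density \<mu> \<in> borel_measurable borel" by (rule Ubar_density_measurable[OF mu])
  have "(\<integral>\<^sup>+t. ennreal (norm (Ubar_density \<mu> t) * \<omega>2 t) \<partial>lborel_delta) =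
      (\<integral>\<^sup>+t\<in>{0..}. ennreal (norm (Ubar_density \<mu> t) * \<omega>2 t) \<partial>lborel) + ennreal (norm (Ubar_density \<mu> 0) * \<omega>2 0)"
    by (intro nn_integral_lborel_delta measurable_restrict_space1) measurable
  also have "(\<integral>\<^sup>+t\<in>{0..}. ennreal (norm (Ubar_density \<mu> t) * \<omega>2 t) \<partial>lborel) =
      (\<integral>\<^sup>+t\<in>{0..}. ennreal (norm (W_op \<psi> \<mu> t) * \<omega>2 t) \<partial>lborel)"
  proof (rule nn_integral_cong_AE)
    show "AE t in lborel. ennreal (norm (Ubar_density \<mu> t) * \<omega>2 t) * indicator {0..} t = ennreal (norm (W_op \<psi> \<mu> t) * \<omega>2 t) * indicator {0..} t"
      using AE_lborel_singleton[of 0] by eventually_elim (simp add: Ubar_density_def)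
  qed
  finally show ?thesis using W_op_L1w[OF mu] by (simp add: L1w_def)
qed

lemma locally_integrable_Ubar_density:
  assumes mu: "\<mu> \<in> Mw \<omega>1" shows "locally_integrable_density lborel_delta (Ubar_density \<mu>)"
proof
  show "Ubar_density \<mu> \<in> borel_measurable lborel_delta"
    by (intro measurable_lborel_deltaI Ubar_density_measurable mu)
  have w: "continuous_on {0..} \<omega>2" "\<forall>t\<ge>0. 0 < \<omega>2 t"
    using w2_pos by (auto intro: continuous_on_subset[OF w2_cont])
  fix b
  obtain m where m: "m > 0" "\<And>t. 0 \<le> t \<Longrightarrow> t \<le> b \<Longrightarrow> m \<le> \<omega>2 t"
    using continuous_pos_lower_bound[OF w, of b] by metis
  note Ubar_density_measurable[OF mu, measurable]
  have "ennreal m * (\<integral>\<^sup>+t\<in>{0..b}. ennreal (norm (Ubar_density \<mu> t)) \<partial>lborel_delta)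
      = (\<integral>\<^sup>+t. ennreal m * (ennreal (norm (Ubar_density \<mu> t)) * indicator {0..b} t) \<partial>lborel_delta)"
    by (intro nn_integral_cmult[symmetric] measurable_lborel_deltaI) measurable
  also have "\<dots> \<le> (\<integral>\<^sup>+t. ennreal (norm (Ubar_density \<mu> t) * \<omega>2 t) \<partial>lborel_delta)"
  proof (rule nn_integral_mono)
    fix t
    show "ennreal m * (ennreal (norm (Ubar_density \<mu> t)) * indicator {0..b} t) \<le> ennreal (norm (Ubar_density \<mu> t) * \<omega>2 t)"
    proof (cases "t \<in> {0..b}")
      case True
      then have "m * norm (Ubar_density \<mu> t) \<le> norm (Ubar_density \<mu> t) * \<omega>2 t"
        using mult_left_mono[OF m(2)[of t], of "norm (Ubar_density \<mu> t)"] by (simp add: mult.commute)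
      then show ?thesis using True m(1) by (simp add: ennreal_mult'[symmetric] ennreal_leI)
    qed simp
  qed
  also have "\<dots> < \<infinity>" by (rule Ubar_density_weighted_finite[OF mu])
  finally show "(\<integral>\<^sup>+t\<in>{0..b}. ennreal (norm (Ubar_density \<mu> t)) \<partial>lborel_delta) < \<infinity>"
    using m(1) by (auto simp: ennreal_mult_less_top)
qed simp

lemma density_cm_Ubar_density:
  assumes mu: "\<mu> \<in> Mw \<omega>1"
  shows "density_cm lborel_delta (Ubar_density \<mu>) = (\<lambda>A. ac_measure (W_op \<psi> \<mu>) A + psi_mass * \<mu> {0} * delta0 A)"
proof
  interpret locally_integrable_density lborel_delta "Ubar_density \<mu>"
    by (rule locally_integrable_Ubar_density[OF mu])
  note Wm [measurable] = W_op_measurable[OF mu] and Um [measurable] = Ubar_density_measurable[OF mu]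
  fix A
  show "density_cm lborel_delta (Ubar_density \<mu>) A = ac_measure (W_op \<psi> \<mu>) A + psi_mass * \<mu> {0} * delta0 A"
  proof (cases "A \<in> cpt_borel")
    case False
    then show ?thesis by (simp add: density_cm_def ac_measure_def delta0_def)
  next
    case True
    then have A [measurable]: "A \<in> sets borel" and A0: "A \<subseteq> {0..}"
      by (auto simp: cpt_borel_iff sets_half_line)
    let ?F = "\<lambda>t. indicator A t *\<^sub>R Ubar_density \<mu> t"
    have "integrable lborel_delta ?F"
      using set_integrable_cpt[OF True] by (simp add: set_integrable_def)
    then have fin: "(\<integral>\<^sup>+t. ennreal (norm (?F t)) \<partial>lborel_delta) < \<infinity>"
      by (simp add: integrable_iff_bounded)
    have "(\<integral>\<^sup>+t. ennreal (norm (?F t)) \<partial>lborel_delta) = (\<integral>\<^sup>+t\<in>{0..}. ennreal (norm (?F t)) \<partial>lborel) + ennreal (norm (?F 0))"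
      by (intro nn_integral_lborel_delta measurable_restrict_space1) measurable
    also have "(\<integral>\<^sup>+t\<in>{0..}. ennreal (norm (?F t)) \<partial>lborel) = (\<integral>\<^sup>+t. ennreal (norm (indicator {0..} t *\<^sub>R ?F t)) \<partial>lborel)"
      by (intro nn_integral_cong) (auto split: split_indicator)
    finally have fin': "(\<integral>\<^sup>+t. ennreal (norm (indicator {0..} t *\<^sub>R ?F t)) \<partial>lborel) < \<infinity>"
      using fin by simp
    have int: "set_integrable lborel {0..} ?F"
      unfolding set_integrable_def by (rule integrableI_bounded[OF _ fin']) measurable
    have "density_cm lborel_delta (Ubar_density \<mu>) A = integral\<^sup>L lborel_delta ?F"
      using True by (simp add: density_cm_def set_lebesgue_integral_def)
    also have "\<dots> = (LINT t:{0..}|lborel. ?F t) + ?F 0"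
    proof (rule integral_lborel_delta[OF _ int])
      show "set_borel_measurable lborel {0..} ?F" unfolding set_borel_measurable_def by measurable
    qed
    also have "(LINT t:{0..}|lborel. ?F t) = (LINT t:A|lborel. W_op \<psi> \<mu> t)"
      unfolding set_lebesgue_integral_def
    proof (rule integral_cong_AE)
      show "AE t in lborel. indicator {0..} t *\<^sub>R ?F t = indicator A t *\<^sub>R W_op \<psi> \<mu> t"
        using AE_lborel_singleton[of 0]
        by eventually_elim (use A0 in \<open>auto simp: Ubar_density_def split: split_indicator\<close>)
    qed measurable
    finally show ?thesis
      using True by (simp add: ac_measure_def delta0_def Ubar_density_0)
  qed
qed

lemma cm_integral_Ubar_density:
  assumes mu: "\<mu> \<in> Mw \<omega>1" and g: "g \<in> C0w \<omega>2"
  shows "cm_integral (density_cm lborel_delta (Ubar_density \<mu>)) g = cm_integral \<mu> (V g)"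
proof -
  interpret locally_integrable_density lborel_delta "Ubar_density \<mu>"
    by (rule locally_integrable_Ubar_density[OF mu])
  note Wm [measurable] = W_op_measurable[OF mu] and Um [measurable] = Ubar_density_measurable[OF mu]
    and gm [measurable] = C0w_measurable[OF g]
  let ?F = "\<lambda>t. Ubar_density \<mu> t * g t"
  have AE: "AE t in lborel. indicator {0..} t *\<^sub>R ?F t = W_op \<psi> \<mu> t * g t"
    using AE_lborel_singleton[of 0]
    by eventually_elim (use g in \<open>auto simp: Ubar_density_def C0w_def split: split_indicator\<close>)
  have "integrable lborel (\<lambda>t. indicator {0..} t *\<^sub>R ?F t)"
    by (subst integrable_cong_AE[OF _ _ AE]) (use cm_integral_V(2)[OF mu g] in auto)
  then have int: "set_integrable lborel {0..} ?F" by (simp add: set_integrable_def)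
  have "integrable lborel_delta ?F"
  proof (rule integrableI_bounded)
    show "?F \<in> borel_measurable lborel_delta" by (intro measurable_lborel_deltaI) measurable
    have "(\<integral>\<^sup>+t. ennreal (norm (?F t)) \<partial>lborel_delta) = (\<integral>\<^sup>+t\<in>{0..}. ennreal (norm (?F t)) \<partial>lborel) + ennreal (norm (?F 0))"
      by (intro nn_integral_lborel_delta measurable_restrict_space1) measurable
    also have "(\<integral>\<^sup>+t\<in>{0..}. ennreal (norm (?F t)) \<partial>lborel) = (\<integral>\<^sup>+t. ennreal (norm (indicator {0..} t *\<^sub>R ?F t)) \<partial>lborel)"
      by (intro nn_integral_cong) (auto split: split_indicator)
    finally show "(\<integral>\<^sup>+t. ennreal (norm (?F t)) \<partial>lborel_delta) < \<infinity>"
      using int unfolding set_integrable_def by (simp add: integrable_iff_bounded)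
  qed
  then have "cm_integral (density_cm lborel_delta (Ubar_density \<mu>)) g = integral\<^sup>L lborel_delta ?F"
    by (intro cm_integral_density measurable_lborel_deltaI gm)
  also have "\<dots> = (LINT t:{0..}|lborel. ?F t) + ?F 0"
    by (rule integral_lborel_delta[OF _ int]) (unfold set_borel_measurable_def, measurable)
  also have "(LINT t:{0..}|lborel. ?F t) = (\<integral>t. W_op \<psi> \<mu> t * g t \<partial>lborel)"
    unfolding set_lebesgue_integral_def by (rule integral_cong_AE[OF _ _ AE]) measurable
  finally show ?thesis
    unfolding cm_integral_V(1)[OF mu g] by (simp only: Ubar_density_0)
qed

lemma Ubar_eq:
  assumes mu: "\<mu> \<in> Mw \<omega>1"
  shows "Ubar \<psi> \<omega>1 \<omega>2 \<mu> = (\<lambda>A. ac_measure (W_op \<psi> \<mu>) A + psi_mass * \<mu> {0} * delta0 A)"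
proof -
  interpret locally_integrable_density lborel_delta "Ubar_density \<mu>"
    by (rule locally_integrable_Ubar_density[OF mu])
  let ?\<nu> = "density_cm lborel_delta (Ubar_density \<mu>)"
  have w: "continuous_on {0..} \<omega>2" "\<forall>t\<ge>0. 0 < \<omega>2 t"
    using w2_pos by (auto intro: continuous_on_subset[OF w2_cont])
  have nu: "?\<nu> \<in> Mw \<omega>2"
    by (rule density_in_Mw[OF w(1) Ubar_density_weighted_finite[OF mu]])
  have "Ubar \<psi> \<omega>1 \<omega>2 \<mu> = ?\<nu>"
    unfolding Ubar_def
  proof (rule the_equality)
    show "?\<nu> \<in> Mw \<omega>2 \<and> (\<forall>g\<in>C0w \<omega>2. cm_integral ?\<nu> g = cm_integral \<mu> (V_op \<psi> \<omega>1 \<omega>2 g))"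
      using nu cm_integral_Ubar_density[OF mu] by (simp add: V_op_eq)
    fix \<nu> assume "\<nu> \<in> Mw \<omega>2 \<and> (\<forall>g\<in>C0w \<omega>2. cm_integral \<nu> g = cm_integral \<mu> (V_op \<psi> \<omega>1 \<omega>2 g))"
    then show "\<nu> = ?\<nu>"
      using cm_integral_Ubar_density[OF mu] by (intro Mw_eqI[OF _ nu w]) (auto simp: V_op_eq)
  qed
  then show ?thesis by (simp only: density_cm_Ubar_density[OF mu])
qed

end

section \<open>Dependence on the values on the half-line\<close>

lemma L1w_cong:
  assumes "\<And>t. t \<ge> 0 \<Longrightarrow> \<omega> t = \<omega>' t" shows "L1w \<omega> = L1w \<omega>'"
proof -
  have "(\<integral>\<^sup>+t\<in>{0..}. ennreal (norm (f t) * \<omega> t) \<partial>lborel) = (\<integral>\<^sup>+t\<in>{0..}. ennreal (norm (f t) * \<omega>' t) \<partial>lborel)"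
    for f :: "real \<Rightarrow> complex"
    by (intro nn_integral_cong) (auto simp: assms split: split_indicator)
  then show ?thesis by (simp add: L1w_def)
qed

lemma C0w_cong:
  assumes "\<And>t. t \<ge> 0 \<Longrightarrow> \<omega> t = \<omega>' t" shows "C0w \<omega> = C0w \<omega>'"
proof -
  have "((\<lambda>t. g t / complex_of_real (\<omega> t)) \<longlongrightarrow> 0) at_top \<longleftrightarrow> ((\<lambda>t. g t / complex_of_real (\<omega>' t)) \<longlongrightarrow> 0) at_top"
    for g :: "real \<Rightarrow> complex"
    by (intro filterlim_cong refl eventually_mono[OF eventually_ge_at_top[of 0]]) (simp add: assms)
  then show ?thesis by (simp add: C0w_def)
qed

lemma Mw_cong:
  assumes "\<And>t. t \<ge> 0 \<Longrightarrow> \<omega> t = \<omega>' t" shows "Mw \<omega> = Mw \<omega>'"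
proof -
  have "(\<integral>\<^sup>+t. ennreal (\<omega> t) \<partial>total_variation \<mu>) = (\<integral>\<^sup>+t. ennreal (\<omega>' t) \<partial>total_variation \<mu>)" for \<mu>
    by (intro nn_integral_cong) (simp add: assms total_variation_eq)
  then show ?thesis by (simp add: Mw_def)
qed

lemma U_op_cong:
  assumes "\<And>t. t \<in> {0..1} \<Longrightarrow> \<psi> t = \<psi>' t" shows "U_op \<psi> = U_op \<psi>'"
  unfolding U_op_def set_lebesgue_integral_def
  by (intro ext Bochner_Integration.integral_cong) (auto simp: assms split: split_indicator)

lemma W_op_cong:
  assumes "\<And>t. t \<in> {0..1} \<Longrightarrow> \<psi> t = \<psi>' t" shows "W_op \<psi> = W_op \<psi>'"
proof -
  have "indicator {0<..<x} s * complex_of_real (\<psi> (s / x)) = indicator {0<..<x} s * complex_of_real (\<psi>' (s / x))" for s x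
    using assms[of "s / x"] by (auto split: split_indicator)
  then show ?thesis by (intro ext) (simp only: W_op_def)
qed

lemma Ubar_cong:
  assumes "\<And>t. t \<in> {0..1} \<Longrightarrow> \<psi> t = \<psi>' t"
    and "\<And>t. t \<ge> 0 \<Longrightarrow> \<omega>1 t = \<omega>1' t" and "\<And>t. t \<ge> 0 \<Longrightarrow> \<omega>2 t = \<omega>2' t"
  shows "Ubar \<psi> \<omega>1 \<omega>2 = Ubar \<psi>' \<omega>1' \<omega>2'"
proof -
  have eqs: "U_op \<psi> = U_op \<psi>'" "C0w \<omega>1 = C0w \<omega>1'" "C0w \<omega>2 = C0w \<omega>2'" "L1w \<omega>1 = L1w \<omega>1'" "Mw \<omega>2 = Mw \<omega>2'"
    using assms by (intro U_op_cong C0w_cong L1w_cong Mw_cong; simp)+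
  show ?thesis
    by (rule ext) (simp only: Ubar_def V_op_def eqs)
qed

section \<open>The range of the extension\<close>

text \<open>
  Evaluation at \<open>{0}\<close> separates the two summands, which makes the decomposition unique.
\<close>

lemma ac_measure_delta0_inj:
  assumes "(\<lambda>A. ac_measure f A + c * delta0 A) = (\<lambda>A. ac_measure f' A + c' * delta0 A)"
  shows "ac_measure f = ac_measure f'" "c = c'"
proof -
  have "ac_measure h {0} = 0" for h
  proof -
    have "(LINT t:{0}|lborel. h t) = (LINT t:{0::real}|lborel. 0)"
      unfolding set_lebesgue_integral_def
    proof (rule integral_cong_AE)
      show "(\<lambda>t. indicator {0} t *\<^sub>R h t) \<in> borel_measurable lborel"
      proof -
        have "(\<lambda>t. indicator {0} t *\<^sub>R h t) = (\<lambda>t::real. indicator {0} t *\<^sub>R h 0)"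
          by (auto split: split_indicator)
        then show ?thesis by simp
      qed
      show "AE t in lborel. indicator {0} t *\<^sub>R h t = indicator {0} t *\<^sub>R 0"
        using AE_lborel_singleton[of 0] by eventually_elim simp
    qed simp
    then show ?thesis by (simp add: ac_measure_def)
  qed
  then show c: "c = c'" using fun_cong[OF assms, of "{0}"] by (simp add: delta0_def)
  show "ac_measure f = ac_measure f'" using fun_cong[OF assms] c by (auto intro!: ext)
qed

lemma in_direct_sum_delta0:
  assumes "f \<in> L1w \<omega>"
  shows "(\<lambda>A. ac_measure f A + c * delta0 A) \<in> direct_sum (ac_measure ` L1w \<omega>) (range (\<lambda>c A. c * delta0 A))"
  unfolding direct_sum_def mem_Collect_eq
proof (rule ex1I[of _ "(ac_measure f, \<lambda>A. c * delta0 A)"])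
  fix q assume "fst q \<in> ac_measure ` L1w \<omega> \<and> snd q \<in> range (\<lambda>c A. c * delta0 A) \<and>
    (\<lambda>A. ac_measure f A + c * delta0 A) = (\<lambda>A. fst q A + snd q A)"
  then obtain f' c' where q: "fst q = ac_measure f'" "snd q = (\<lambda>A. c' * delta0 A)"
    and eq: "(\<lambda>A. ac_measure f A + c * delta0 A) = (\<lambda>A. ac_measure f' A + c' * delta0 A)"
    by auto
  show "q = (ac_measure f, \<lambda>A. c * delta0 A)"
    using ac_measure_delta0_inj[OF eq] q by (simp add: prod_eq_iff)
qed (use assms in auto)

theorem proposition3p3:
  fixes \<psi> \<omega>1 \<omega>2 :: "real \<Rightarrow> real"
  assumes "continuous_on {0..1} \<psi>" and "\<forall>t\<in>{0..1}. 0 \<le> \<psi> t"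
    and "continuous_on {0..} \<omega>1" and "\<forall>t\<ge>0. 0 < \<omega>1 t"
    and "continuous_on {0..} \<omega>2" and "\<forall>t\<ge>0. 0 < \<omega>2 t"
    and "\<exists>C::real. \<forall>s\<ge>0.
      (\<integral>\<^sup>+t\<in>{0..1}. ennreal (\<omega>2 (s / t) * (\<psi> t / t)) \<partial>lborel) \<le> ennreal (C * \<omega>1 s)"
  shows "(\<forall>\<mu>\<in>Mw \<omega>1.
        W_op \<psi> \<mu> \<in> L1w \<omega>2 \<and>
        Ubar \<psi> \<omega>1 \<omega>2 \<mu> =
          (\<lambda>A. ac_measure (W_op \<psi> \<mu>) A
            + complex_of_real (LINT t:{0..1}|lborel. \<psi> t / t) * \<mu> {0} * delta0 A))
    \<and> Ubar \<psi> \<omega>1 \<omega>2 ` Mw \<omega>1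
        \<subseteq> direct_sum (ac_measure ` L1w \<omega>2) (range (\<lambda>c A. c * delta0 A))
    \<and> Ubar \<psi> \<omega>1 \<omega>2 ` Mw_pos \<omega>1 \<subseteq> ac_measure ` L1w \<omega>2"
proof -
  obtain C where C: "\<And>s. s \<ge> 0 \<Longrightarrow>
      (\<integral>\<^sup>+t\<in>{0..1}. ennreal (\<omega>2 (s / t) * (\<psi> t / t)) \<partial>lborel) \<le> ennreal (C * \<omega>1 s)"
    using assms(7) by blast
  \<comment> \<open>Extend the three functions by constants, so that they are continuous on the whole line.\<close>
  define \<psi>' where "\<psi>' t = \<psi> (max 0 (min 1 t))" for t
  define \<omega>1' where "\<omega>1' t = \<omega>1 (max 0 t)" for t
  define \<omega>2' where "\<omega>2' t = \<omega>2 (max 0 t)" for t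
  have psi: "\<psi> t = \<psi>' t" if "t \<in> {0..1}" for t using that by (simp add: \<psi>'_def)
  have w1: "\<omega>1 t = \<omega>1' t" if "t \<ge> 0" for t using that by (simp add: \<omega>1'_def)
  have w2: "\<omega>2 t = \<omega>2' t" if "t \<ge> 0" for t using that by (simp add: \<omega>2'_def)
  interpret hardy_cesaro \<psi>' \<omega>1' \<omega>2' "\<bar>C\<bar>"
  proof
    show "continuous_on UNIV \<psi>'" "continuous_on UNIV \<omega>1'" "continuous_on UNIV \<omega>2'"
      unfolding \<psi>'_def \<omega>1'_def \<omega>2'_def
      by (rule continuous_on_compose2[OF assms(1)] continuous_on_compose2[OF assms(3)]
            continuous_on_compose2[OF assms(5)], intro continuous_intros, force)+
    show "0 \<le> \<psi>' t" "0 < \<omega>1' t" "0 < \<omega>2' t" for t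
      using assms(2,4,6) by (simp_all add: \<psi>'_def \<omega>1'_def \<omega>2'_def)
    fix s :: real assume s: "s \<ge> 0"
    have "(\<integral>\<^sup>+t\<in>{0..1}. ennreal (\<omega>2' (s / t) * (\<psi>' t / t)) \<partial>lborel)
        = (\<integral>\<^sup>+t\<in>{0..1}. ennreal (\<omega>2 (s / t) * (\<psi> t / t)) \<partial>lborel)"
      using s psi w2 by (intro nn_integral_cong) (auto split: split_indicator)
    also have "\<dots> \<le> ennreal (C * \<omega>1 s)" by (rule C[OF s])
    also have "\<dots> \<le> ennreal (\<bar>C\<bar> * \<omega>1' s)"
    proof (intro ennreal_leI)
      have "0 < \<omega>1 s" using s assms(4) by blast
      then show "C * \<omega>1 s \<le> \<bar>C\<bar> * \<omega>1' s" unfolding w1[OF s, symmetric] by (intro mult_right_mono) auto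
    qed
    finally show "(\<integral>\<^sup>+t\<in>{0..1}. ennreal (\<omega>2' (s / t) * (\<psi>' t / t)) \<partial>lborel) \<le> ennreal (\<bar>C\<bar> * \<omega>1' s)" .
  qed simp
  have mass: "psi_mass = complex_of_real (LINT t:{0..1}|lborel. \<psi> t / t)"
    unfolding psi_mass_def set_lebesgue_integral_def using psi
    by (intro arg_cong[where f=complex_of_real] Bochner_Integration.integral_cong) (auto split: split_indicator)
  have cong: "W_op \<psi> = W_op \<psi>'" "Ubar \<psi> \<omega>1 \<omega>2 = Ubar \<psi>' \<omega>1' \<omega>2'" "L1w \<omega>2 = L1w \<omega>2'" "Mw \<omega>1 = Mw \<omega>1'"
    using psi w1 w2 by (intro W_op_cong Ubar_cong L1w_cong Mw_cong; simp)+
  have W: "W_op \<psi> \<mu> \<in> L1w \<omega>2" if "\<mu> \<in> Mw \<omega>1" for \<mu>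
    using W_op_L1w[of \<mu>] that by (simp add: cong)
  have U: "Ubar \<psi> \<omega>1 \<omega>2 \<mu> = (\<lambda>A. ac_measure (W_op \<psi> \<mu>) A
        + complex_of_real (LINT t:{0..1}|lborel. \<psi> t / t) * \<mu> {0} * delta0 A)" if "\<mu> \<in> Mw \<omega>1" for \<mu>
    using Ubar_eq[of \<mu>] that by (simp only: cong mass)
  have "Ubar \<psi> \<omega>1 \<omega>2 \<mu> \<in> ac_measure ` L1w \<omega>2" if "\<mu> \<in> Mw_pos \<omega>1" for \<mu>
  proof -
    have mu: "\<mu> \<in> Mw \<omega>1" "\<mu> {0} = 0" using that by (auto simp: Mw_pos_def)
    have "Ubar \<psi> \<omega>1 \<omega>2 \<mu> = ac_measure (W_op \<psi> \<mu>)" unfolding U[OF mu(1)] mu(2) by simp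
    then show ?thesis using W[OF mu(1)] by simp
  qed
  moreover have "Ubar \<psi> \<omega>1 \<omega>2 \<mu> \<in> direct_sum (ac_measure ` L1w \<omega>2) (range (\<lambda>c A. c * delta0 A))"
    if "\<mu> \<in> Mw \<omega>1" for \<mu>
    unfolding U[OF that] by (rule in_direct_sum_delta0[OF W[OF that]])
  ultimately show ?thesis using W U by blast
qed

end
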